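(* If $n > 3$ is an integer with $f(n) \geq \sqrt{e^{\gamma} n \log\log n}$, then $n$ is practical.
   Context: For a natural number $n$, let $f(n)$ be the largest integer such that every integer in $\{1,2,\dots,f(n)\}$ can be written as a sum of distinct (positive) divisors of $n$. A natural number $n$ is practical if every integer in $[1,n-1]$ (equivalently, $f(n)\geq n-1$) can be written as a sum of distinct divisors of $n$. $\gamma$ denotes the Euler--Mascheroni constant. *)

theory Defs
  imports "HOL-Analysis.Analysis"
begin

definition sum_of_distinct_divisors :: "nat \<Rightarrow> nat \<Rightarrow> bool" where
  "sum_of_distinct_divisors n k \<longleftrightarrow> (\<exists>D. finite D \<and> D \<subseteq> {d. d dvd n} \<and> k = \<Sum>D)"

text \<open>The maximum below is over a finite nonempty set for every \<open>n > 0\<close> (see the lemmas that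
  follow); the value at \<open>n = 0\<close> carries no meaning.\<close>

definition f :: "nat \<Rightarrow> nat" where
  "f n = Max {m. \<forall>k\<in>{1..m}. sum_of_distinct_divisors n k}"

definition practical :: "nat \<Rightarrow> bool" where
  "practical n \<longleftrightarrow> n > 0 \<and> (\<forall>k\<in>{1..n - 1}. sum_of_distinct_divisors n k)"

lemma finite_f_set:
  assumes "n > 0"
  shows "finite {m. \<forall>k\<in>{1..m}. sum_of_distinct_divisors n k}"
proof (rule finite_subset)
  show "{m. \<forall>k\<in>{1..m}. sum_of_distinct_divisors n k} \<subseteq> {..\<Sum>{d. d dvd n}}"
  proof
    fix m assume m: "m \<in> {m. \<forall>k\<in>{1..m}. sum_of_distinct_divisors n k}"
    show "m \<in> {..\<Sum>{d. d dvd n}}"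
    proof (cases "m = 0")
      case False
      then have "m \<in> {1..m}" by simp
      with m have "sum_of_distinct_divisors n m" by blast
      then obtain D where D: "D \<subseteq> {d. d dvd n}" "m = \<Sum>D"
        unfolding sum_of_distinct_divisors_def by blast
      have "\<Sum>D \<le> \<Sum>{d. d dvd n}"
        by (rule sum_mono2) (use assms D in simp_all)
      with D show ?thesis by simp
    qed simp
  qed
qed simp

lemma le_f_iff:
  assumes "n > 0"
  shows "m \<le> f n \<longleftrightarrow> (\<forall>k\<in>{1..m}. sum_of_distinct_divisors n k)"
proof -
  let ?S = "{m. \<forall>k\<in>{1..m}. sum_of_distinct_divisors n k}"
  have fin: "finite ?S" by (rule finite_f_set[OF assms])
  have "0 \<in> ?S" by simp
  then have "f n \<in> ?S" unfolding f_def using Max_in[OF fin] by blast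
  then have reach: "\<forall>k\<in>{1..f n}. sum_of_distinct_divisors n k" by simp
  show ?thesis
  proof
    assume "m \<le> f n"
    then have "{1..m} \<subseteq> {1..f n}" by simp
    with reach show "\<forall>k\<in>{1..m}. sum_of_distinct_divisors n k" by blast
  next
    assume "\<forall>k\<in>{1..m}. sum_of_distinct_divisors n k"
    then have "m \<in> ?S" by simp
    then show "m \<le> f n" unfolding f_def by (rule Max_ge[OF fin])
  qed
qed

lemma practical_iff_f:
  assumes "n > 0"
  shows "practical n \<longleftrightarrow> f n \<ge> n - 1"
  using assms by (simp add: practical_def le_f_iff)

end

theory Submission
  imports Defs "HOL-Number_Theory.Prime_Powers" "HOL-Real_Asymp.Real_Asymp"
begin

text \<open>
  If \<open>n\<close> is not practical, then by Stewart's criterion \<open>n = m r\<close> where every prime factor of \<open>r > 1\<close>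
  exceeds \<open>\<sigma>(m) + 1\<close>. Hence \<open>\<sigma>(m) + 1\<close> is not a sum of distinct divisors of \<open>n\<close>, so \<open>f n \<le> \<sigma>(m)\<close>, while
  \<open>n \<ge> m (\<sigma>(m) + 2)\<close>. As \<open>ln n \<ge> 2 ln m\<close>, it suffices that
  \<open>\<sigma>(m) / m < e\<^sup>\<gamma> (ln (ln m) + ln 2)\<close>, up to finitely many \<open>m\<close>: this is weaker than Robin's bound by
  the term \<open>ln 2\<close>, which leaves room for an elementary proof.

  Write \<open>S(x)\<close>, \<open>A(x)\<close>, \<open>\<psi>(x)\<close> for the sums over \<open>d \<le> x\<close> of \<open>\<Lambda>(d) / (d ln d)\<close>, \<open>\<Lambda>(d) / d\<close>, \<open>\<Lambda>(d)\<close>. Since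
  \<open>ln (\<sigma>(m) / m)\<close> is at most the sum of \<open>\<Lambda>(d) / (d ln d)\<close> over \<open>d\<close> dividing \<open>m\<close>, an exchange argument
  gives \<open>ln (\<sigma>(m) / m) \<le> S(x) + (ln m - \<psi>(x)) / (x ln x)\<close> for every \<open>x > 1\<close>. If \<open>A(t) \<ge> ln t + e\<close> for all
  \<open>t \<ge> x\<close>, partial summation and the value \<open>\<gamma>\<close> of the constant in Mertens' theorem yield
  \<open>S(x) \<le> \<gamma> + ln (ln x) + (A(x) - ln x - e) / ln x\<close>. At \<open>x = ln m\<close> only \<open>A(x) - \<psi>(x) / x\<close> has to be bounded
  from above and \<open>A\<close> from below. As \<open>x A(x) = ln \<lfloor>x\<rfloor>! + \<Sum> \<Lambda>(d) frac (x / d)\<close>, both follow from Chebyshev's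
  method with step functions below \<open>1 - frac\<close> and \<open>frac\<close>. This settles \<open>ln m \<ge> 900\<close>; below that, the
  exchange argument with \<open>x\<close> equal to 5, 23, 128 and 450 suffices.
\<close>

section \<open>Sums of distinct divisors\<close>


definition divisor_sum :: "nat \<Rightarrow> nat" where
  "divisor_sum n = \<Sum>{d. d dvd n}"

lemma sum_of_distinct_divisors_iff:
  assumes "n > 0"
  shows "sum_of_distinct_divisors n k \<longleftrightarrow> (\<exists>D \<subseteq> {d. d dvd n}. k = \<Sum>D)"
  unfolding sum_of_distinct_divisors_def
  using finite_subset[OF _ finite_divisors_nat[OF assms]] by auto

lemma divisor_sum_1 [simp]: "divisor_sum (Suc 0) = 1"
  by (simp add: divisor_sum_def)

lemma divisor_sum_ge:
  assumes "n > 0"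
  shows "n \<le> divisor_sum n"
  unfolding divisor_sum_def by (rule member_le_sum) (use assms in auto)

lemma divisor_sum_pos: "n > 0 \<Longrightarrow> divisor_sum n > 0"
  using divisor_sum_ge[of n] by simp

lemma divisors_prime_power_mult:
  fixes p m :: nat
  assumes p: "prime p" and m: "m > 0" "\<not> p dvd m"
  shows "{d. d dvd p ^ Suc b * m} = {d. d dvd p ^ b * m} \<union> (*) (p ^ Suc b) ` {d. d dvd m}"
    and "{d. d dvd p ^ b * m} \<inter> (*) (p ^ Suc b) ` {d. d dvd m} = {}"
proof -
  show "{d. d dvd p ^ Suc b * m} = {d. d dvd p ^ b * m} \<union> (*) (p ^ Suc b) ` {d. d dvd m}"
  proof (intro equalityI subsetI)
    fix d assume "d \<in> {d. d dvd p ^ Suc b * m}"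
    then have d: "d dvd p ^ Suc b * m" by simp
    obtain a c where ac: "d = a * c" "a dvd p ^ Suc b" "c dvd m"
      using division_decomp[OF d] by blast
    obtain i where i: "i \<le> Suc b" "a = p ^ i"
      using ac(2) divides_primepow_nat[OF p, of a "Suc b"] by blast
    show "d \<in> {d. d dvd p ^ b * m} \<union> (*) (p ^ Suc b) ` {d. d dvd m}"
    proof (cases "i = Suc b")
      case True then show ?thesis using ac i by auto
    next
      case False
      then have "a dvd p ^ b" using i by (simp add: le_imp_power_dvd)
      then show ?thesis using ac by (auto intro: mult_dvd_mono)
    qed
  next
    fix d assume "d \<in> {d. d dvd p ^ b * m} \<union> (*) (p ^ Suc b) ` {d. d dvd m}"
    then show "d \<in> {d. d dvd p ^ Suc b * m}"
      by (auto intro: dvd_mult simp: mult.assoc)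
  qed
  show "{d. d dvd p ^ b * m} \<inter> (*) (p ^ Suc b) ` {d. d dvd m} = {}"
  proof (rule ccontr)
    assume "{d. d dvd p ^ b * m} \<inter> (*) (p ^ Suc b) ` {d. d dvd m} \<noteq> {}"
    then obtain d where "d dvd p ^ b * m" "d \<in> (*) (p ^ Suc b) ` {d. d dvd m}" by blast
    then obtain c where "p ^ Suc b * c dvd p ^ b * m" by (elim imageE) simp
    then have "p ^ Suc b dvd p ^ b * m" by (rule dvd_mult_left)
    then have "p dvd m" using p by (auto simp: mult.assoc mult.left_commute prime_gt_0_nat)
    with m show False by simp
  qed
qed

lemma divisor_sum_prime_power_mult:
  fixes p m :: nat
  assumes p: "prime p" and m: "m > 0" "\<not> p dvd m"
  shows "divisor_sum (p ^ Suc b * m) = divisor_sum (p ^ b * m) + p ^ Suc b * divisor_sum m"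
proof -
  have "p > 0" using p by (simp add: prime_gt_0_nat)
  then have fin: "finite {d. d dvd p ^ b * m}" "finite {d. d dvd m}"
    using m by (auto intro!: finite_divisors_nat)
  have "\<Sum>((*) (p ^ Suc b) ` {d. d dvd m}) = p ^ Suc b * \<Sum>{d. d dvd m}"
    using \<open>p > 0\<close> by (subst sum.reindex) (auto simp: inj_on_def sum_distrib_left)
  then show ?thesis
    unfolding divisor_sum_def divisors_prime_power_mult(1)[OF assms]
    using fin by (subst sum.union_disjoint[OF _ _ divisors_prime_power_mult(2)[OF assms]]) auto
qed

text \<open>Division with remainder by p ^ (b + 1): the quotient is a sum of divisors of m, scaled
  by that power, and the remainder a sum of divisors of p ^ b * m. The second claim keeps every
  proper remainder within reach, so both claims go through one induction.\<close>

lemma all_sums_prime_power_mult: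
  fixes p m :: nat
  assumes p: "prime p" and m: "m > 0" "\<not> p dvd m"
    and le: "p \<le> divisor_sum m + 1"
    and reach: "\<And>k. k \<le> divisor_sum m \<Longrightarrow> sum_of_distinct_divisors m k"
  shows "k \<le> divisor_sum (p ^ b * m) \<Longrightarrow> sum_of_distinct_divisors (p ^ b * m) k"
    and "p ^ Suc b \<le> divisor_sum (p ^ b * m) + 1"
proof (induction b arbitrary: k)
  case 0
  { case 1 then show ?case using reach by simp }
  { case 2 then show ?case using le by simp }
next
  case (Suc b)
  note eq = divisor_sum_prime_power_mult[OF p m, of b]
  have p0: "p > 0" using p by (simp add: prime_gt_0_nat)
  have pos: "p ^ b * m > 0" "p ^ Suc b * m > 0" using p0 m by auto
  { case 1
    \<comment> \<open>Quotients above sigma(m) are not sums of divisors of m. When the cap is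
      active, the remainder may exceed p ^ (b + 1), but the recursion for \<open>divisor_sum\<close>
      still bounds it by sigma(p ^ b * m).\<close>
    define q where "q = min (divisor_sum m) (k div p ^ Suc b)"
    have qle: "q * p ^ Suc b \<le> k"
      unfolding q_def by (metis min.cobounded2 div_times_less_eq_dividend mult_le_mono1 order_trans)
    have rle: "k - q * p ^ Suc b \<le> divisor_sum (p ^ b * m)"
    proof (cases "divisor_sum m \<le> k div p ^ Suc b")
      case True
      then show ?thesis using 1 eq by (simp add: q_def mult.commute)
    next
      case False
      then have "k - q * p ^ Suc b = k mod p ^ Suc b"
        by (simp add: q_def minus_div_mult_eq_mod)
      also have "\<dots> < p ^ Suc b" using p0 by simp
      finally show ?thesis using Suc.IH(2) by linarith
    qed
    obtain D where D: "D \<subseteq> {d. d dvd p ^ b * m}" "k - q * p ^ Suc b = \<Sum>D"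
      using Suc.IH(1)[OF rle] sum_of_distinct_divisors_iff[OF pos(1)] by blast
    have "q \<le> divisor_sum m" by (simp add: q_def)
    then obtain C where C: "C \<subseteq> {d. d dvd m}" "q = \<Sum>C"
      using reach sum_of_distinct_divisors_iff[OF m(1)] by blast
    let ?C = "(*) (p ^ Suc b) ` C"
    have "finite C" using C(1) m by (auto intro: finite_subset)
    then have fin: "finite D" "finite ?C"
      using D(1) pos by (auto intro: finite_subset)
    have "D \<inter> ?C = {}"
      using divisors_prime_power_mult(2)[OF p m, of b] D(1) C(1) by blast
    then have "\<Sum>(D \<union> ?C) = \<Sum>D + \<Sum>?C" using fin by (simp add: sum.union_disjoint)
    also have "\<Sum>?C = p ^ Suc b * q"
      using p0 by (subst sum.reindex) (auto simp: inj_on_def sum_distrib_left C)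
    finally have "k = \<Sum>(D \<union> ?C)" using D(2) qle by (simp add: mult.commute)
    moreover have "D \<union> ?C \<subseteq> {d. d dvd p ^ Suc b * m}"
      unfolding divisors_prime_power_mult(1)[OF p m] using D(1) C(1) by blast
    ultimately show ?case using sum_of_distinct_divisors_iff[OF pos(2)] by blast }
  { case 2
    have "p ^ Suc (Suc b) \<le> p ^ Suc b * (divisor_sum m + 1)"
      using le mult_le_mono2[of p "divisor_sum m + 1" "p ^ Suc b"] by (simp add: mult.commute)
    then show ?case using eq Suc.IH(2) by (simp add: algebra_simps) }
qed

lemma Max_prime_factor_split:
  fixes n :: nat
  assumes "n > 1"
  obtains p a m where "prime p" "a > 0" "n = p ^ a * m" "m > 0" "\<not> p dvd m" "m < n"
    "\<And>q. prime q \<Longrightarrow> q dvd m \<Longrightarrow> q < p"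
proof -
  define p where "p = Max (prime_factors n)"
  have "prime_factors n \<noteq> {}"
    using assms prime_factorization_empty_iff[of n] by auto
  then have "p \<in> prime_factors n" unfolding p_def by (intro Max_in) auto
  then have p: "prime p" "p dvd n" by auto
  have le: "q \<le> p" if "prime q" "q dvd n" for q
    unfolding p_def using that assms by (intro Max_ge) (auto simp: prime_factors_dvd)
  define a where "a = multiplicity p n"
  define m where "m = n div p ^ a"
  have nm: "n = p ^ a * m" unfolding m_def a_def by (simp add: multiplicity_dvd)
  have a: "a > 0" unfolding a_def using p assms by (simp add: prime_multiplicity_gt_zero_iff)
  have m0: "m > 0" using nm assms by (cases "m = 0") auto
  have "\<not> p dvd m"
    unfolding m_def a_def using p assms by (intro multiplicity_decompose) auto
  moreover have "m < n"
  proof -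
    have "1 < p ^ a" using p a by (intro one_less_power prime_gt_1_nat) auto
    then show ?thesis using nm m0 by (metis mult_less_cancel2 mult_1)
  qed
  moreover have "q < p" if "prime q" "q dvd m" for q
    using le[of q] that nm \<open>\<not> p dvd m\<close> by (metis dvd_mult order_le_less)
  ultimately show ?thesis using that p a nm m0 by blast
qed

text \<open>Stewart's criterion, organised by removing the largest prime: as soon as one prime exceeds
  \<open>\<sigma>(m) + 1\<close>, where \<open>m\<close> is the part of \<open>n\<close> built from smaller primes, so do all later ones.\<close>

lemma all_sums_or_gap:
  fixes n :: nat
  assumes "n > 0"
  shows "(\<forall>k \<le> divisor_sum n. sum_of_distinct_divisors n k) \<or>
    (\<exists>m r. n = m * r \<and> r > 1 \<and> (\<forall>q. prime q \<longrightarrow> q dvd r \<longrightarrow> q > divisor_sum m + 1))"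
  using assms
proof (induction n rule: less_induct)
  case (less n)
  show ?case
  proof (cases "n = 1")
    case True
    have "sum_of_distinct_divisors 1 0" "sum_of_distinct_divisors 1 1"
      unfolding sum_of_distinct_divisors_def by (intro exI[of _ "{}"] exI[of _ "{1}"]; simp)+
    then have "sum_of_distinct_divisors 1 k" if "k \<le> 1" for k
      using that by (cases "k = 0") (auto simp: le_Suc_eq)
    then show ?thesis using True by auto
  next
    case False
    with less.prems have "n > 1" by simp
    then obtain p a m where pm: "prime p" "a > 0" "n = p ^ a * m" "m > 0" "\<not> p dvd m" "m < n"
      "\<And>q. prime q \<Longrightarrow> q dvd m \<Longrightarrow> q < p" by (rule Max_prime_factor_split) blast
    have pa: "p ^ a > 1" using pm by (intro one_less_power prime_gt_1_nat) auto
    from less.IH[OF pm(6) pm(4)] show ?thesis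
    proof
      assume reach: "\<forall>k \<le> divisor_sum m. sum_of_distinct_divisors m k"
      show ?thesis
      proof (cases "p \<le> divisor_sum m + 1")
        case True
        then show ?thesis
          using all_sums_prime_power_mult(1)[OF pm(1,4,5)] reach pm(3) by blast
      next
        case False
        have "q > divisor_sum m + 1" if "prime q" "q dvd p ^ a" for q
          using that pm(1) False by (metis not_less prime_dvd_power primes_dvd_imp_eq)
        then show ?thesis using pm pa by (metis mult.commute)
      qed
    next
      assume "\<exists>k r. m = k * r \<and> r > 1 \<and> (\<forall>q. prime q \<longrightarrow> q dvd r \<longrightarrow> q > divisor_sum k + 1)"
      then obtain k r where kr: "m = k * r" "r > 1"
        "\<And>q. prime q \<Longrightarrow> q dvd r \<Longrightarrow> q > divisor_sum k + 1" by blast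
      obtain q where q: "prime q" "q dvd r" using kr(2) prime_factor_nat[of r] by auto
      have "divisor_sum k + 1 < q" "q < p" using kr(3)[OF q] pm(7)[of q] q kr(1) by auto
      then have p: "p > divisor_sum k + 1" by simp
      have "l > divisor_sum k + 1" if "prime l" "l dvd r * p ^ a" for l
        using that p kr(3) pm(1) by (metis prime_dvd_mult_iff prime_dvd_power primes_dvd_imp_eq)
      moreover have "r * p ^ a > 1" using kr(2) pa by (metis less_1_mult)
      moreover have "n = k * (r * p ^ a)" using pm(3) kr(1) by simp
      ultimately show ?thesis by blast
    qed
  qed
qed

text \<open>A divisor of n used in a representation of sigma(m) + 1 is at most sigma(m) + 1, hence
  smaller than every prime factor of r; it is therefore coprime to r and divides m. Such divisors
  add up to at most sigma(m), so sigma(m) + 1 is out of reach. The bound on n is r \<ge> sigma(m) +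
  2.\<close>

lemma not_practical_imp_gap:
  fixes n :: nat
  assumes n: "n > 0" and np: "\<not> practical n"
  obtains m where "m > 0" "f n \<le> divisor_sum m" "n \<ge> m * (divisor_sum m + 2)"
proof -
  have "\<not> (\<forall>k \<le> divisor_sum n. sum_of_distinct_divisors n k)"
    using np n divisor_sum_ge[OF n] unfolding practical_def
    by (meson atLeastAtMost_iff diff_le_self order_trans)
  then obtain m r where mr: "n = m * r" "r > 1"
    "\<And>q. prime q \<Longrightarrow> q dvd r \<Longrightarrow> q > divisor_sum m + 1"
    using all_sums_or_gap[OF n] by blast
  have m: "m > 0" using mr n by (cases "m = 0") auto
  obtain q where q: "prime q" "q dvd r" using mr(2) prime_factor_nat[of r] by auto
  have "divisor_sum m + 2 \<le> r" using mr(3)[OF q] q mr(2) dvd_imp_le[of q r] by simp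
  then have "n \<ge> m * (divisor_sum m + 2)" unfolding mr(1) by (rule mult_le_mono2)
  moreover have "f n \<le> divisor_sum m"
  proof (rule ccontr)
    assume "\<not> ?thesis"
    then have "divisor_sum m + 1 \<le> f n" by simp
    then have "\<forall>k\<in>{1..divisor_sum m + 1}. sum_of_distinct_divisors n k"
      using le_f_iff[OF n] by blast
    then have "sum_of_distinct_divisors n (divisor_sum m + 1)" by simp
    then obtain D where D: "finite D" "D \<subseteq> {d. d dvd n}" "divisor_sum m + 1 = \<Sum>D"
      unfolding sum_of_distinct_divisors_def by blast
    have "d dvd m" if d: "d \<in> D" for d
    proof -
      have dn: "d dvd m * r" using D(2) d mr(1) by blast
      have "d \<le> divisor_sum m + 1" unfolding D(3) using D(1) d by (intro member_le_sum) auto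
      moreover have "d > 0" using dn mr(1) n by (metis dvd_0_left gr0I)
      ultimately have small: "q \<le> divisor_sum m + 1" if "q dvd d" for q
        using dvd_imp_le[OF that] by simp
      have "coprime d r"
      proof (rule ccontr)
        assume "\<not> coprime d r"
        then obtain q where "prime q" "q dvd d" "q dvd r"
          using prime_factor_nat[of "gcd d r"] by (auto simp: coprime_iff_gcd_eq_1)
        then show False using small[of q] mr(3)[of q] by simp
      qed
      then show ?thesis using dn by (simp add: coprime_dvd_mult_left_iff)
    qed
    then have "\<Sum>D \<le> divisor_sum m"
      unfolding divisor_sum_def using m by (intro sum_mono2) auto
    then show False using D(3) by simp
  qed
  ultimately show ?thesis using that m by blast
qed

section \<open>The divisor sum and the von Mangoldt function\<close>


text \<open>The Dirichlet coefficients of ln zeta(1 + s): 1 / (k p^k) at a prime power p^k and 0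
  elsewhere. At d = 1 the denominator vanishes and the quotient is 0 by convention.\<close>

definition mangoldt_log_coeff :: "nat \<Rightarrow> real" where
  "mangoldt_log_coeff d = mangoldt d / (real d * ln (real d))"

definition mangoldt_log_sum :: "real \<Rightarrow> real" where
  "mangoldt_log_sum x = (\<Sum>d = 1..nat \<lfloor>x\<rfloor>. mangoldt_log_coeff d)"

definition mangoldt_over_sum :: "real \<Rightarrow> real" where
  "mangoldt_over_sum x = (\<Sum>d = 1..nat \<lfloor>x\<rfloor>. mangoldt d / real d)"

definition chebyshev_psi :: "real \<Rightarrow> real" where
  "chebyshev_psi x = (\<Sum>d = 1..nat \<lfloor>x\<rfloor>. mangoldt d)"

lemma mangoldt_log_coeff_nonneg: "mangoldt_log_coeff d \<ge> 0"
  unfolding mangoldt_log_coeff_def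
  by (cases "d = 0") (auto intro!: divide_nonneg_nonneg mult_nonneg_nonneg mangoldt_nonneg)

lemma mangoldt_log_coeff_primepow:
  assumes "prime p" "k > 0"
  shows "mangoldt_log_coeff (p ^ k) = 1 / (real k * real p ^ k)"
proof -
  have "real p > 1" using prime_gt_1_nat[OF assms(1)] by simp
  then have "ln (real p) > 0" by simp
  then show ?thesis
    using assms \<open>real p > 1\<close> by (simp add: mangoldt_log_coeff_def ln_realpow field_simps)
qed

text \<open>With q = 1 / p the left side is the logarithm of sigma(p^a) / p^a. The crude bound - ln
  (1 - q) would charge for all powers of p; keeping the numerator 1 - q^(a+1) of the geometric sum
  pays for the powers beyond p^a.\<close>

lemma ln_geometric_le:
  fixes q :: real
  assumes q: "0 \<le> q" "q \<le> 1 / 2" and a: "a > 0"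
  shows "ln (\<Sum>i\<le>a. q ^ i) \<le> (\<Sum>j = 1..a. q ^ j / real j)"
proof -
  \<comment> \<open>The term t^(a+1) stands for - ln (1 - t^(a+1)), which is at least as large. The
    derivative is t^a (a + 1 - 1 / (1 - t)), nonnegative because t \<le> 1/2 gives 1 / (1 - t) \<le>
    2 \<le> a + 1.\<close>
  define h where "h = (\<lambda>t::real. (\<Sum>j = 1..a. t ^ j / real j) + ln (1 - t) + t ^ Suc a)"
  have "h 0 \<le> h q"
  proof (rule DERIV_nonneg_imp_nondecreasing[OF q(1)])
    fix t :: real assume t: "0 \<le> t" "t \<le> q"
    have "((\<lambda>t. \<Sum>j = 1..a. t ^ j / real j) has_real_derivative (\<Sum>j = 1..a. t ^ (j - 1))) (at t)"
      by (auto intro!: derivative_eq_intros sum.cong)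
    moreover have "((\<lambda>t. ln (1 - t)) has_real_derivative - 1 / (1 - t)) (at t)"
      using t q by (auto intro!: derivative_eq_intros)
    moreover have "((\<lambda>t. t ^ Suc a) has_real_derivative real (Suc a) * t ^ a) (at t)"
      using DERIV_pow[of "Suc a" t] by simp
    ultimately have "((\<lambda>t. (\<Sum>j = 1..a. t ^ j / real j) + ln (1 - t) + t ^ Suc a) has_real_derivative
       (\<Sum>j = 1..a. t ^ (j - 1)) + - 1 / (1 - t) + real (Suc a) * t ^ a) (at t)"
      by (intro DERIV_add)
    moreover have "(\<Sum>j = 1..a. t ^ (j - 1)) + - 1 / (1 - t) + real (Suc a) * t ^ a
        = t ^ a * (real (Suc a) - 1 / (1 - t))"
    proof -
      have "(\<Sum>j = 1..a. t ^ (j - 1)) = (\<Sum>j<a. t ^ j)"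
        by (rule sum.reindex_bij_witness[of _ Suc "\<lambda>j. j - 1"]) auto
      also have "\<dots> = (1 - t ^ a) / (1 - t)" using t q by (simp add: sum_gp_strict)
      finally show ?thesis using t q by (simp add: field_simps)
    qed
    moreover have "1 / (1 - t) \<le> real (Suc a)"
    proof -
      have "1 / (1 - t) \<le> 2" using t q by (simp add: field_simps)
      then show ?thesis using a by linarith
    qed
    ultimately have "(h has_real_derivative t ^ a * (real (Suc a) - 1 / (1 - t))) (at t)"
        "t ^ a * (real (Suc a) - 1 / (1 - t)) \<ge> 0"
      unfolding h_def using t by (simp_all only: diff_ge_0_iff_ge mult_nonneg_nonneg zero_le_power)
    then show "\<exists>y. (h has_real_derivative y) (at t) \<and> 0 \<le> y" by blast
  qed
  then have 1: "- ln (1 - q) - q ^ Suc a \<le> (\<Sum>j = 1..a. q ^ j / real j)"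
    using a by (simp add: h_def power_0_left)
  have "q ^ a \<le> 1" using q by (intro power_le_one) auto
  then have "q * q ^ a \<le> 1 / 2 * 1" using q by (intro mult_mono) auto
  then have qa: "q ^ Suc a < 1" by simp
  have "(\<Sum>i\<le>a. q ^ i) = (1 - q ^ Suc a) / (1 - q)"
    using q by (simp add: sum_gp0)
  then have "ln (\<Sum>i\<le>a. q ^ i) = ln (1 - q ^ Suc a) - ln (1 - q)"
    using q qa by (simp add: ln_div)
  also have "ln (1 - q ^ Suc a) \<le> - (q ^ Suc a)"
    using qa ln_le_minus_one[of "1 - q ^ Suc a"] by simp
  finally show ?thesis using 1 by simp
qed

lemma divisor_sum_prime_power_mult':
  fixes p m :: nat
  assumes "prime p" "m > 0" "\<not> p dvd m"
  shows "divisor_sum (p ^ a * m) = (\<Sum>i\<le>a. p ^ i) * divisor_sum m"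
  by (induction a) (simp_all only: divisor_sum_prime_power_mult[OF assms],
      simp_all add: algebra_simps)

text \<open>Induction by splitting off the largest prime p: the factor sigma(p^a) / p^a is paid for
  by p, ..., p^a, which divide n and are disjoint from the divisors of m.\<close>

lemma ln_divisor_sum_le:
  fixes n :: nat
  assumes "n > 0"
  shows "ln (divisor_sum n / n) \<le> (\<Sum>d | d dvd n. mangoldt_log_coeff d)"
  using assms
proof (induction n rule: less_induct)
  case (less n)
  show ?case
  proof (cases "n = 1")
    case True
    then show ?thesis by (simp add: mangoldt_log_coeff_def)
  next
    case False
    with less.prems have "n > 1" by simp
    then obtain p a m where pm: "prime p" "a > 0" "n = p ^ a * m" "m > 0" "\<not> p dvd m" "m < n"
      by (rule Max_prime_factor_split) blast
    have p2: "real p \<ge> 2" using pm(1) prime_ge_2_nat[of p] by simp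
    define q where "q = 1 / real p"
    have q: "0 \<le> q" "q \<le> 1 / 2" using p2 by (auto simp: q_def field_simps)
    have "(\<Sum>i\<le>a. real p ^ i) / real p ^ a = (\<Sum>i\<le>a. real p ^ i / real p ^ a)"
      by (simp add: sum_divide_distrib)
    also have "\<dots> = (\<Sum>i\<le>a. q ^ i)"
      by (rule sum.reindex_bij_witness[of _ "\<lambda>i. a - i" "\<lambda>i. a - i"])
        (use p2 in \<open>auto simp: q_def power_diff power_divide\<close>)
    finally have "divisor_sum n / n = (\<Sum>i\<le>a. q ^ i) * (divisor_sum m / m)"
      unfolding pm(3) divisor_sum_prime_power_mult'[OF pm(1,4,5)] by (simp flip: times_divide_times_eq)
    moreover have "(\<Sum>i\<le>a. q ^ i) > 0"
      using q by (intro sum_pos2[of _ 0]) auto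
    moreover have "divisor_sum m / m > 0" using pm(4) divisor_sum_pos[of m] by simp
    ultimately have "ln (divisor_sum n / n) = ln (\<Sum>i\<le>a. q ^ i) + ln (divisor_sum m / m)"
      by (simp only: ln_mult_pos)
    also have "\<dots> \<le> (\<Sum>j = 1..a. q ^ j / real j) + (\<Sum>d | d dvd m. mangoldt_log_coeff d)"
      using ln_geometric_le[OF q pm(2)] less.IH[OF pm(6,4)] by simp
    also have "(\<Sum>j = 1..a. q ^ j / real j) = (\<Sum>d\<in>(^) p ` {1..a}. mangoldt_log_coeff d)"
    proof -
      have "inj_on ((^) p) {1..a}" using p2 by (auto simp: inj_on_def)
      then show ?thesis
        by (subst sum.reindex)
          (auto simp: mangoldt_log_coeff_primepow pm(1) q_def power_divide field_simps intro!: sum.cong)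
    qed
    also have "\<dots> + (\<Sum>d | d dvd m. mangoldt_log_coeff d) =
        (\<Sum>d\<in>(^) p ` {1..a} \<union> {d. d dvd m}. mangoldt_log_coeff d)"
    proof (rule sum.union_disjoint[symmetric])
      show "(^) p ` {1..a} \<inter> {d. d dvd m} = {}"
      proof -
        have "\<not> p ^ j dvd m" if "j \<in> {1..a}" for j
          using that pm(5) dvd_trans[OF dvd_power[of j p]] by auto
        then show ?thesis by blast
      qed
    qed (use pm(4) in auto)
    also have "\<dots> \<le> (\<Sum>d | d dvd n. mangoldt_log_coeff d)"
      using less.prems pm(3)
      by (intro sum_mono2 mangoldt_log_coeff_nonneg) (auto simp: le_imp_power_dvd intro: dvd_mult2)
    finally show ?thesis .
  qed
qed

text \<open>Exchange argument: \<open>1 / (d ln d) \<ge> 1 / (x ln x)\<close> exactly when \<open>d \<le> x\<close>, so the sum over the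
  prime powers dividing \<open>n\<close> is at most the sum over all prime powers up to \<open>x\<close>, corrected by the
  difference of the total weights \<open>ln n\<close> and \<open>\<psi>(x)\<close>.\<close>

lemma ln_divisor_sum_le_exchange:
  fixes n :: nat and x :: real
  assumes n: "n > 0" and x: "x > 1"
  shows "ln (divisor_sum n / n) \<le>
    mangoldt_log_sum x + (ln n - chebyshev_psi x) / (x * ln x)"
proof -
  define c where "c = 1 / (x * ln x)"
  define g where "g = (\<lambda>d. mangoldt_log_coeff d - c * mangoldt d)"
  have lnx: "ln x > 0" using x by simp
  have g1: "g (Suc 0) = 0" by (simp add: g_def mangoldt_log_coeff_def)
  have g: "g d = mangoldt d * (1 / (real d * ln (real d)) - c)" for d
    by (simp add: g_def mangoldt_log_coeff_def algebra_simps)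
  have pos: "g d \<ge> 0" if "d \<ge> 1" "real d \<le> x" for d
  proof (cases "d = 1")
    case False
    with that have d: "real d > 1" by simp
    then have "real d * ln (real d) \<le> x * ln x" using that x by (intro mult_mono) auto
    then have "c \<le> 1 / (real d * ln (real d))"
      unfolding c_def using d lnx x by (intro divide_left_mono mult_pos_pos) auto
    then show ?thesis unfolding g by (intro mult_nonneg_nonneg mangoldt_nonneg) auto
  qed (simp add: g1)
  have neg: "g d \<le> 0" if "real d > x" for d
  proof -
    have "x * ln x \<le> real d * ln (real d)" using that x by (intro mult_mono) auto
    then have "1 / (real d * ln (real d)) \<le> c"
      unfolding c_def using that x lnx by (intro divide_left_mono mult_pos_pos) auto
    then show ?thesis unfolding g by (intro mult_nonneg_nonpos mangoldt_nonneg) auto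
  qed
  have mem: "d \<in> {1..nat \<lfloor>x\<rfloor>} \<longleftrightarrow> d \<ge> 1 \<and> real d \<le> x" for d
    using x by (auto simp: le_nat_iff le_floor_iff)
  have fin: "finite {d. d dvd n}" using n by simp
  have "(\<Sum>d | d dvd n. g d) \<le> (\<Sum>d\<in>{d. d dvd n} \<inter> {1..nat \<lfloor>x\<rfloor>}. g d)"
  proof -
    have "(\<Sum>d | d dvd n. g d) = (\<Sum>d\<in>{d. d dvd n} \<inter> {1..nat \<lfloor>x\<rfloor>}. g d)
        + (\<Sum>d\<in>{d. d dvd n} - {1..nat \<lfloor>x\<rfloor>}. g d)"
      by (rule sum.Int_Diff[OF fin])
    moreover have "(\<Sum>d\<in>{d. d dvd n} - {1..nat \<lfloor>x\<rfloor>}. g d) \<le> 0"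
    proof (intro sum_nonpos neg)
      fix d assume d: "d \<in> {d. d dvd n} - {1..nat \<lfloor>x\<rfloor>}"
      then have "d \<ge> 1" using n by (cases "d = 0") auto
      then show "real d > x" using d mem[of d] by auto
    qed
    ultimately show ?thesis by simp
  qed
  also have "\<dots> \<le> (\<Sum>d = 1..nat \<lfloor>x\<rfloor>. g d)"
    using pos mem by (intro sum_mono2) auto
  also have "\<dots> = mangoldt_log_sum x - c * chebyshev_psi x"
    by (simp add: g_def sum_subtractf sum_distrib_left mangoldt_log_sum_def chebyshev_psi_def)
  finally have "(\<Sum>d | d dvd n. mangoldt_log_coeff d) - c * ln n
      \<le> mangoldt_log_sum x - c * chebyshev_psi x"
    using mangoldt_sum[of n, where ?'a = real] n
    by (simp add: g_def sum_subtractf flip: sum_distrib_left)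
  then show ?thesis using ln_divisor_sum_le[OF n] by (simp add: c_def field_simps diff_divide_distrib)
qed

section \<open>The constant in Mertens' theorem\<close>


lemma sum_power_over_le_ln:
  fixes q :: real
  assumes "0 \<le> q" "q < 1"
  shows "(\<Sum>k = 1..K. q ^ k / real k) \<le> - ln (1 - q)"
proof -
  define h where "h = (\<lambda>t::real. - ln (1 - t) - (\<Sum>k = 1..K. t ^ k / real k))"
  have "h 0 \<le> h q"
  proof (rule DERIV_nonneg_imp_nondecreasing[OF assms(1)])
    fix t :: real assume t: "0 \<le> t" "t \<le> q"
    have "((\<lambda>t. \<Sum>k = 1..K. t ^ k / real k) has_real_derivative (\<Sum>k = 1..K. t ^ (k - 1))) (at t)"
      by (auto intro!: derivative_eq_intros sum.cong)
    moreover have "((\<lambda>t. - ln (1 - t)) has_real_derivative 1 / (1 - t)) (at t)"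
      using t assms by (auto intro!: derivative_eq_intros)
    ultimately have "(h has_real_derivative 1 / (1 - t) - (\<Sum>k = 1..K. t ^ (k - 1))) (at t)"
      unfolding h_def by (intro DERIV_diff)
    moreover have "(\<Sum>k = 1..K. t ^ (k - 1)) = (\<Sum>k<K. t ^ k)"
      by (rule sum.reindex_bij_witness[of _ Suc "\<lambda>k. k - 1"]) auto
    moreover have "(\<Sum>k<K. t ^ k) = (1 - t ^ K) / (1 - t)"
      using t assms by (simp add: sum_gp_strict)
    moreover have "(1 - t ^ K) / (1 - t) \<le> 1 / (1 - t)"
      using t assms by (intro divide_right_mono) auto
    ultimately have "(h has_real_derivative 1 / (1 - t) - (1 - t ^ K) / (1 - t)) (at t)"
      "1 / (1 - t) - (1 - t ^ K) / (1 - t) \<ge> 0" by simp_all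
    then show "\<exists>y. (h has_real_derivative y) (at t) \<and> 0 \<le> y" by blast
  qed
  then show ?thesis by (simp add: h_def power_0_left)
qed

text \<open>Every prime power up to N is some p^k with p and k at most N, and the sum over k is a
  truncated logarithm series. The case e > 0 feeds the Euler product; e = 0 is included for the
  numerical bounds in \<open>prime_product_bounds\<close>.\<close>

lemma sum_mangoldt_log_coeff_le_primes:
  fixes e :: real
  assumes e: "e \<ge> 0"
  shows "(\<Sum>n = 1..N. mangoldt_log_coeff n * real n powr - e)
    \<le> (\<Sum>p | prime p \<and> p \<le> N. - ln (1 - real p powr - (1 + e)))"
proof -
  let ?P = "{p. prime p \<and> p \<le> N}"
  let ?g = "\<lambda>n. mangoldt_log_coeff n * real n powr - e"
  have finP: "finite ?P" by (rule finite_subset[of _ "{..N}"]) auto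
  have "(\<Sum>n = 1..N. ?g n) = (\<Sum>n | n \<in> {1..N} \<and> primepow n. ?g n)"
    by (rule sum.mono_neutral_right) (auto simp: mangoldt_log_coeff_def mangoldt_def)
  also have "\<dots> \<le> (\<Sum>n\<in>(\<lambda>(p, k). p ^ k) ` (?P \<times> {1..N}). ?g n)"
  proof (intro sum_mono2 subsetI)
    fix n assume n: "n \<in> {n. n \<in> {1..N} \<and> primepow n}"
    then obtain p k where pk: "prime p" "k > 0" "n = p ^ k" by (auto simp: primepow_def)
    have "p \<le> p ^ k" using pk prime_ge_1_nat[of p] by (intro self_le_power) auto
    moreover have "k < p ^ k" using prime_gt_1_nat[OF pk(1)] by (simp add: less_exp power_gt_expt)
    ultimately show "n \<in> (\<lambda>(p, k). p ^ k) ` (?P \<times> {1..N})"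
      using pk n by (auto intro!: image_eqI[of _ _ "(p, k)"])
  qed (use finP in \<open>auto intro!: mult_nonneg_nonneg mangoldt_log_coeff_nonneg\<close>)
  also have "\<dots> \<le> (\<Sum>(p, k)\<in>?P \<times> {1..N}. ?g (p ^ k))"
  proof -
    have "(\<Sum>n\<in>(\<lambda>(p, k). p ^ k) ` (?P \<times> {1..N}). ?g n) \<le> sum (?g \<circ> (\<lambda>(p, k). p ^ k)) (?P \<times> {1..N})"
      using finP by (intro sum_image_le mult_nonneg_nonneg mangoldt_log_coeff_nonneg) auto
    also have "\<dots> = (\<Sum>(p, k)\<in>?P \<times> {1..N}. ?g (p ^ k))" by (rule sum.cong) auto
    finally show ?thesis .
  qed
  also have "\<dots> = (\<Sum>p\<in>?P. \<Sum>k = 1..N. ?g (p ^ k))"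
    by (simp add: sum.cartesian_product)
  also have "\<dots> \<le> (\<Sum>p\<in>?P. - ln (1 - real p powr - (1 + e)))"
  proof (rule sum_mono)
    fix p assume p: "p \<in> ?P"
    then have p1: "real p > 1" using prime_gt_1_nat[of p] by simp
    have "?g (p ^ k) = (real p powr - (1 + e)) ^ k / real k" if "k \<in> {1..N}" for k
    proof -
      have "(real p powr - (1 + e)) ^ k = real p powr (- (1 + e) * real k)"
        using p1 by (simp add: powr_powr flip: powr_realpow)
      also have "\<dots> = real p powr (- real k + - e * real k)" by (simp add: algebra_simps)
      also have "\<dots> = real p powr - real k * (real p powr real k) powr - e"
        by (simp only: powr_add powr_powr) (simp add: mult.commute)
      also have "\<dots> = 1 / real p ^ k * real (p ^ k) powr - e"
        using p1 by (simp add: powr_minus powr_realpow field_simps)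
      finally show ?thesis using p that by (simp add: mangoldt_log_coeff_primepow)
    qed
    then have "(\<Sum>k = 1..N. ?g (p ^ k)) = (\<Sum>k = 1..N. (real p powr - (1 + e)) ^ k / real k)" by simp
    also have "real p powr - (1 + e) < 1"
      using p1 e powr_less_mono[of "- (1 + e)" 0 "real p"] by simp
    then have "(\<Sum>k = 1..N. (real p powr - (1 + e)) ^ k / real k) \<le> - ln (1 - real p powr - (1 + e))"
      by (intro sum_power_over_le_ln) auto
    finally show "(\<Sum>k = 1..N. ?g (p ^ k)) \<le> - ln (1 - real p powr - (1 + e))" .
  qed
  finally show ?thesis .
qed

text \<open>Comparison with the integral of t^(-1-e), carried out termwise by the mean value
  theorem. The subtracted tail makes the bound strong enough to be its own induction
  hypothesis.\<close>

lemma sum_powr_le: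
  fixes e :: real
  assumes e: "e > 0"
  shows "(\<Sum>n = 1..Suc M. real n powr - (1 + e)) \<le> 1 + 1 / e - real (Suc M) powr - e / e"
proof (induction M)
  case (Suc M)
  let ?a = "real (Suc M)"
  have "\<exists>z > ?a. z < ?a + 1 \<and> (?a + 1) powr - e - ?a powr - e = (?a + 1 - ?a) * (- e * z powr (- e - 1))"
    by (rule MVT2) (auto intro!: derivative_eq_intros)
  then obtain z where z: "z > ?a" "z < ?a + 1"
    "(?a + 1) powr - e - ?a powr - e = - e * z powr (- e - 1)" by auto
  have "(?a + 1) powr (- e - 1) \<le> z powr (- e - 1)"
    using z e by (intro powr_mono2') auto
  then have "e * (?a + 1) powr (- e - 1) \<le> ?a powr - e - (?a + 1) powr - e"
    using mult_left_mono[of "(?a + 1) powr (- e - 1)" "z powr (- e - 1)" e] z(3) e by linarith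
  then have "(?a + 1) powr (- e - 1) \<le> (?a powr - e - (?a + 1) powr - e) / e"
    using e by (simp add: pos_le_divide_eq mult.commute)
  then show ?case using Suc.IH by (simp add: diff_divide_distrib add.commute minus_diff_commute)
qed simp

lemma finite_sum_powr_le:
  fixes e :: real
  assumes e: "e > 0" and D: "finite D" "0 \<notin> D"
  shows "(\<Sum>n\<in>D. real n powr - (1 + e)) \<le> 1 + 1 / e"
proof -
  obtain M where "D \<subseteq> {..M}" using D(1) finite_nat_iff_bounded_le by blast
  then have "(\<Sum>n\<in>D. real n powr - (1 + e)) \<le> (\<Sum>n = 1..Suc M. real n powr - (1 + e))"
    using D(2) by (intro sum_mono2) (auto simp: Suc_le_eq intro!: gr0I le_SucI)
  also have "\<dots> \<le> 1 + 1 / e - real (Suc M) powr - e / e"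
    by (rule sum_powr_le[OF e])
  also have "\<dots> \<le> 1 + 1 / e" using e by simp
  finally show ?thesis .
qed

text \<open>Expanding the product yields each integer at most once, by unique factorization. The
  clause on prime factors is the invariant behind this: a new prime p divides no element of the old
  D, so its exponent can be read off from p^k * n.\<close>

lemma prod_truncated_euler_factors:
  fixes s :: real
  assumes "finite P" "\<And>p. p \<in> P \<Longrightarrow> prime p"
  shows "\<exists>D. finite D \<and> (\<forall>n\<in>D. n > 0 \<and> (\<forall>q. prime q \<longrightarrow> q dvd n \<longrightarrow> q \<in> P)) \<and>
    (\<Prod>p\<in>P. \<Sum>k\<le>K. (real p powr s) ^ k) = (\<Sum>n\<in>D. real n powr s)"
  using assms
proof (induction P rule: finite_induct)
  case empty
  show ?case by (intro exI[of _ "{1}"]) auto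
next
  case (insert p P)
  then obtain D where D: "finite D" "\<And>n. n \<in> D \<Longrightarrow> n > 0"
    "\<And>n q. n \<in> D \<Longrightarrow> prime q \<Longrightarrow> q dvd n \<Longrightarrow> q \<in> P"
    "(\<Prod>p\<in>P. \<Sum>k\<le>K. (real p powr s) ^ k) = (\<Sum>n\<in>D. real n powr s)" by blast
  have p: "prime p" using insert.prems by simp
  have p0: "p > 0" using p by (simp add: prime_gt_0_nat)
  have ndvd: "\<not> p dvd n" if "n \<in> D" for n using D(3)[OF that p] insert.hyps by blast
  define h where "h = (\<lambda>(k, n). p ^ k * n :: nat)"
  have inj: "inj_on h ({..K} \<times> D)"
  proof (rule inj_onI, clarify)
    fix k n l m assume *: "n \<in> D" "m \<in> D" "h (k, n) = h (l, m)"
    have mult: "multiplicity p (p ^ i * j) = i" if "j \<in> D" for i j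
      using p ndvd[OF that] D(2)[OF that]
      by (simp add: prime_elem_multiplicity_mult_distrib not_dvd_imp_multiplicity_0)
    have "k = l" using *(3) mult[OF *(1), of k] mult[OF *(2), of l] by (simp add: h_def)
    then show "k = l \<and> n = m" using *(3) p0 by (simp add: h_def)
  qed
  have "(\<Prod>q\<in>insert p P. \<Sum>k\<le>K. (real q powr s) ^ k) =
      (\<Sum>k\<le>K. (real p powr s) ^ k) * (\<Sum>n\<in>D. real n powr s)"
    using insert.hyps D(4) by simp
  also have "\<dots> = (\<Sum>(k, n)\<in>{..K} \<times> D. (real p powr s) ^ k * real n powr s)"
    by (simp add: sum_product sum.cartesian_product)
  also have "\<dots> = (\<Sum>x\<in>{..K} \<times> D. real (h x) powr s)"
    using p0 by (intro sum.cong) (auto simp: h_def powr_mult powr_powr mult.commute simp flip: powr_realpow)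
  also have "\<dots> = (\<Sum>n\<in>h ` ({..K} \<times> D). real n powr s)"
    using inj by (simp add: sum.reindex)
  finally have "(\<Prod>q\<in>insert p P. \<Sum>k\<le>K. (real q powr s) ^ k) = (\<Sum>n\<in>h ` ({..K} \<times> D). real n powr s)" .
  moreover have "n > 0 \<and> (\<forall>q. prime q \<longrightarrow> q dvd n \<longrightarrow> q \<in> insert p P)"
    if n: "n \<in> h ` ({..K} \<times> D)" for n
  proof -
    obtain k j where kj: "n = p ^ k * j" "j \<in> D" using n by (auto simp: h_def)
    have "q \<in> insert p P" if "prime q" "q dvd n" for q
      using that kj D(3)[OF kj(2)] p
      by (metis insertCI prime_dvd_mult_iff prime_dvd_power primes_dvd_imp_eq)
    then show ?thesis using kj D(2) p0 by auto
  qed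
  ultimately show ?case using D(1) by (intro exI[of _ "h ` ({..K} \<times> D)"]) auto
qed

text \<open>For fixed N, the truncated Euler products are sums of n^(-1-e) over finite sets of
  positive integers, hence at most 1 + 1 / e; letting K tend to infinity completes the geometric
  series. No infinite product or value of zeta enters.\<close>

lemma sum_mangoldt_log_coeff_powr_le:
  fixes e :: real
  assumes e: "e > 0"
  shows "(\<Sum>n = 1..N. mangoldt_log_coeff n * real n powr - e) \<le> ln (1 + 1 / e)"
proof -
  let ?P = "{p. prime p \<and> p \<le> N}"
  have finP: "finite ?P" by (rule finite_subset[of _ "{..N}"]) auto
  have q: "0 < real p powr - (1 + e) \<and> real p powr - (1 + e) < 1" if "p \<in> ?P" for p
  proof -
    have "real p > 1" using that prime_gt_1_nat[of p] by simp
    then show ?thesis using e powr_less_mono[of "- (1 + e)" 0 "real p"] by simp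
  qed
  have "(\<lambda>K. \<Prod>p\<in>?P. \<Sum>k\<le>K. (real p powr - (1 + e)) ^ k)
      \<longlonglongrightarrow> (\<Prod>p\<in>?P. 1 / (1 - real p powr - (1 + e)))"
  proof (intro tendsto_prod)
    fix p assume "p \<in> ?P"
    then have "(\<lambda>k. (real p powr - (1 + e)) ^ k) sums (1 / (1 - real p powr - (1 + e)))"
      using q[of p] by (intro geometric_sums) auto
    then show "(\<lambda>K. \<Sum>k\<le>K. (real p powr - (1 + e)) ^ k) \<longlonglongrightarrow> 1 / (1 - real p powr - (1 + e))"
      by (simp add: sums_def_le)
  qed
  moreover have "(\<Prod>p\<in>?P. \<Sum>k\<le>K. (real p powr - (1 + e)) ^ k) \<le> 1 + 1 / e" for K
  proof -
    obtain D where D: "finite D" "\<forall>n\<in>D. n > 0"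
      "(\<Prod>p\<in>?P. \<Sum>k\<le>K. (real p powr - (1 + e)) ^ k) = (\<Sum>n\<in>D. real n powr - (1 + e))"
      using prod_truncated_euler_factors[OF finP, of "- (1 + e)" K] by auto
    have "0 \<notin> D" using D(2) by auto
    then show ?thesis unfolding D(3) by (rule finite_sum_powr_le[OF e D(1)])
  qed
  ultimately have le: "(\<Prod>p\<in>?P. 1 / (1 - real p powr - (1 + e))) \<le> 1 + 1 / e"
    by (intro LIMSEQ_le_const2) auto
  have q': "1 / (1 - real p powr - (1 + e)) > 0" if "p \<in> ?P" for p
    using q[OF that] by simp
  have "(\<Sum>p\<in>?P. - ln (1 - real p powr - (1 + e))) = (\<Sum>p\<in>?P. ln (1 / (1 - real p powr - (1 + e))))"
    using q by (intro sum.cong) (auto simp: ln_div)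
  also have "\<dots> = ln (\<Prod>p\<in>?P. 1 / (1 - real p powr - (1 + e)))"
    by (rule ln_prod[symmetric, OF finP]) (rule less_imp_neq[OF q', THEN not_sym])
  also have "\<dots> \<le> ln (1 + 1 / e)"
    by (intro ln_mono prod_pos) (rule q' le | assumption)+
  finally show ?thesis using sum_mangoldt_log_coeff_le_primes[of e N] e by simp
qed

section \<open>Laplace transforms and the identification of the constant\<close>

lemma nn_integral_exp_tail:
  "(\<integral>\<^sup>+u. ennreal (exp (- u)) * indicator {a..} u \<partial>lborel) = ennreal (exp (- a :: real))"
proof -
  have "(\<integral>\<^sup>+u. ennreal (exp (- u)) * indicator {a..} u \<partial>lborel) = ennreal (0 - (- exp (- a)))"
  proof (rule nn_integral_FTC_atLeast)
    show "((\<lambda>u::real. - exp (- u)) \<longlongrightarrow> 0) at_top" by real_asymp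
  qed (auto intro!: derivative_eq_intros)
  then show ?thesis by simp
qed

text \<open>Laplace transform of the step function \<open>S(t) = mangoldt_log_sum t\<close> in the variable
  \<open>u = e ln t\<close>.\<close>

lemma nn_integral_mangoldt_log_sum_le:
  fixes e :: real
  assumes e: "e > 0"
  shows "(\<integral>\<^sup>+u. ennreal (mangoldt_log_sum (exp (u / e)) * exp (- u)) * indicator {0..} u \<partial>lborel)
    \<le> ennreal (ln (1 + 1 / e))"
    and "(\<lambda>u. ennreal (mangoldt_log_sum (exp (u / e)) * exp (- u)) * indicator {0..} u) \<in> borel_measurable lborel"
proof -
  let ?c = "\<lambda>n. mangoldt_log_coeff (Suc n)"
  \<comment> \<open>The step function is split into its jumps: d = n + 1 enters exactly when u \<ge>
    e ln d, and integrating that jump against exp (- u) gives the coefficient times d^(-e).\<close>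
  define g where "g = (\<lambda>n u. ennreal (?c n) * (ennreal (exp (- u)) * indicator {e * ln (real (Suc n))..} u))"
  have meas: "g n \<in> borel_measurable lborel" for n
    unfolding g_def by measurable
  have eq: "ennreal (mangoldt_log_sum (exp (u / e)) * exp (- u)) * indicator {0..} u = (\<Sum>n. g n u)" for u
  proof (cases "u \<ge> 0")
    case True
    define N where "N = nat \<lfloor>exp (u / e)\<rfloor>"
    have iff: "e * ln (real (Suc n)) \<le> u \<longleftrightarrow> n < N" for n
    proof -
      have "e * ln (real (Suc n)) \<le> u \<longleftrightarrow> ln (real (Suc n)) \<le> u / e"
        using e by (simp add: field_simps)
      also have "\<dots> \<longleftrightarrow> real (Suc n) \<le> exp (u / e)"
        by (metis exp_le_cancel_iff exp_ln of_nat_0_less_iff zero_less_Suc)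
      also have "\<dots> \<longleftrightarrow> Suc n \<le> N"
        unfolding N_def by (auto simp: le_nat_iff le_floor_iff)
      finally show ?thesis by (simp add: Suc_le_eq)
    qed
    have "(\<Sum>n. g n u) = (\<Sum>n<N. g n u)"
      by (rule suminf_finite) (auto simp: g_def iff indicator_def simp del: of_nat_Suc)
    also have "\<dots> = (\<Sum>n<N. ennreal (?c n * exp (- u)))"
      by (intro sum.cong) (auto simp: g_def iff indicator_def ennreal_mult mangoldt_log_coeff_nonneg simp del: of_nat_Suc)
    also have "\<dots> = ennreal (\<Sum>n<N. ?c n * exp (- u))"
      by (intro sum_ennreal) (auto intro!: mult_nonneg_nonneg mangoldt_log_coeff_nonneg)
    also have "(\<Sum>n<N. ?c n * exp (- u)) = mangoldt_log_sum (exp (u / e)) * exp (- u)"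
      unfolding mangoldt_log_sum_def N_def[symmetric] sum_distrib_right
      by (rule sum.reindex_bij_witness[of _ "\<lambda>n. n - 1" Suc]) auto
    finally show ?thesis using True by simp
  next
    case False
    have "e * ln (real (Suc n)) \<ge> 0" for n using e by simp
    then have "g n u = 0" for n
      using False order_trans[of 0 "e * ln (real (Suc n))" u] by (auto simp: g_def indicator_def)
    then show ?thesis using False by simp
  qed
  show "(\<lambda>u. ennreal (mangoldt_log_sum (exp (u / e)) * exp (- u)) * indicator {0..} u) \<in> borel_measurable lborel"
    unfolding eq using meas by measurable
  have int: "(\<integral>\<^sup>+u. g n u \<partial>lborel) = ennreal (?c n * real (Suc n) powr - e)" for n
  proof -
    have "(\<integral>\<^sup>+u. g n u \<partial>lborel) =
        ennreal (?c n) * (\<integral>\<^sup>+u. ennreal (exp (- u)) * indicator {e * ln (real (Suc n))..} u \<partial>lborel)"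
      unfolding g_def by (rule nn_integral_cmult) measurable
    also have "\<dots> = ennreal (?c n) * ennreal (exp (- (e * ln (real (Suc n)))))"
      by (simp only: nn_integral_exp_tail)
    also have "exp (- (e * ln (real (Suc n)))) = real (Suc n) powr - e"
      by (simp add: powr_def)
    finally show ?thesis by (simp only: ennreal_mult'[OF mangoldt_log_coeff_nonneg])
  qed
  have "(\<integral>\<^sup>+u. (\<Sum>n. g n u) \<partial>lborel) = (\<Sum>n. ennreal (?c n * real (Suc n) powr - e))"
    using meas by (simp add: nn_integral_suminf int)
  also have "\<dots> \<le> ennreal (ln (1 + 1 / e))"
  proof (rule suminf_le_const)
    fix N
    have "(\<Sum>n<N. ennreal (?c n * real (Suc n) powr - e)) = ennreal (\<Sum>n<N. ?c n * real (Suc n) powr - e)"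
      by (intro sum_ennreal) (auto intro!: mult_nonneg_nonneg mangoldt_log_coeff_nonneg)
    also have "(\<Sum>n<N. ?c n * real (Suc n) powr - e) = (\<Sum>n = 1..N. mangoldt_log_coeff n * real n powr - e)"
      by (rule sum.reindex_bij_witness[of _ "\<lambda>n. n - 1" Suc]) auto
    also have "ennreal \<dots> \<le> ennreal (ln (1 + 1 / e))"
      by (intro ennreal_leI sum_mangoldt_log_coeff_powr_le e)
    finally show "(\<Sum>n<N. ennreal (?c n * real (Suc n) powr - e)) \<le> ennreal (ln (1 + 1 / e))" .
  qed simp
  finally show "(\<integral>\<^sup>+u. ennreal (mangoldt_log_sum (exp (u / e)) * exp (- u)) * indicator {0..} u \<partial>lborel)
    \<le> ennreal (ln (1 + 1 / e))" unfolding eq .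
qed

text \<open>This minorant replaces ln u by a power, whose Laplace transform is a Gamma value; the
  integral of exp (- u) ln u is thereby avoided.\<close>

lemma one_minus_powr_le_ln:
  fixes u d :: real
  assumes "u > 0" "d > 0"
  shows "(1 - u powr - d) / d \<le> ln u"
proof -
  have "1 + (- d * ln u) \<le> exp (- d * ln u)" by (rule exp_ge_add_one_self)
  then have "1 - u powr - d \<le> d * ln u" using assms by (simp add: powr_def)
  then show ?thesis using assms by (simp add: pos_divide_le_eq mult.commute)
qed

text \<open>For u \<ge> e ln x0 the hypothesis at t = exp (u / e) and
  \<open>one_minus_powr_le_ln\<close> give c - ln e + 1 / d \<le> S(t) + u^(-d) / d; multiply by exp
  (- u) and integrate. The power is moved to the right so that all integrands are
  nonnegative.\<close>

lemma mangoldt_log_sum_laplace_bound: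
  fixes c x0 e d :: real
  assumes x0: "x0 > 1" and S: "\<And>t. t \<ge> x0 \<Longrightarrow> mangoldt_log_sum t \<ge> ln (ln t) + c"
    and e: "e > 0" and d: "0 < d" "d < 1" and C: "c - ln e + 1 / d \<ge> 0"
  shows "(c - ln e + 1 / d) * exp (- (e * ln x0)) \<le> ln (1 + 1 / e) + Gamma (1 - d) / d"
proof -
  let ?C = "c - ln e + 1 / d"
  let ?a = "e * ln x0"
  have a: "?a > 0" using e x0 by simp
  let ?F = "\<lambda>u. ennreal (mangoldt_log_sum (exp (u / e)) * exp (- u)) * indicator {0..} u"
  let ?G = "\<lambda>u. ennreal (1 / d) * ennreal (indicator {0..} u * u powr ((1 - d) - 1) / exp u)"
  have "ennreal (?C * exp (- ?a)) = (\<integral>\<^sup>+u. ennreal ?C * (ennreal (exp (- u)) * indicator {?a..} u) \<partial>lborel)"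
    by (subst nn_integral_cmult) (simp_all only: nn_integral_exp_tail ennreal_mult'[OF C], measurable)
  also have "\<dots> \<le> (\<integral>\<^sup>+u. ?F u + ?G u \<partial>lborel)"
  proof (rule nn_integral_mono)
    fix u :: real
    show "ennreal ?C * (ennreal (exp (- u)) * indicator {?a..} u) \<le> ?F u + ?G u"
    proof (cases "u \<ge> ?a")
      case True
      then have u: "u > 0" using a by linarith
      have "ln x0 \<le> u / e" using True e by (simp add: field_simps)
      then have "x0 \<le> exp (u / e)" using x0 by (metis exp_le_cancel_iff exp_ln less_trans zero_less_one)
      then have 1: "mangoldt_log_sum (exp (u / e)) \<ge> ln (u / e) + c" using S by fastforce
      have 2: "ln (u / e) = ln u - ln e" using u e by (simp add: ln_div)
      have 3: "?C \<le> mangoldt_log_sum (exp (u / e)) + u powr - d / d"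
        using one_minus_powr_le_ln[OF u d(1)] 1 2 by (simp add: diff_divide_distrib)
      have S0: "mangoldt_log_sum (exp (u / e)) \<ge> 0"
        unfolding mangoldt_log_sum_def by (intro sum_nonneg mangoldt_log_coeff_nonneg)
      have "?C * exp (- u) \<le> (mangoldt_log_sum (exp (u / e)) + u powr - d / d) * exp (- u)"
        using 3 by (intro mult_right_mono) auto
      also have "\<dots> = mangoldt_log_sum (exp (u / e)) * exp (- u) + 1 / d * (u powr - d / exp u)"
        by (simp add: algebra_simps exp_minus divide_simps)
      finally have "ennreal (?C * exp (- u)) \<le>
          ennreal (mangoldt_log_sum (exp (u / e)) * exp (- u) + 1 / d * (u powr - d / exp u))"
        by (rule ennreal_leI)
      also have "\<dots> = ennreal (mangoldt_log_sum (exp (u / e)) * exp (- u)) + ennreal (1 / d * (u powr - d / exp u))"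
        using S0 d by (intro ennreal_plus) auto
      finally have "ennreal (?C * exp (- u)) \<le>
          ennreal (mangoldt_log_sum (exp (u / e)) * exp (- u)) + ennreal (1 / d * (u powr - d / exp u))" .
      moreover have "ennreal ?C * (ennreal (exp (- u)) * indicator {?a..} u) = ennreal (?C * exp (- u))"
        using True by (simp only: ennreal_mult'[OF C] indicator_simps atLeast_iff mult_1_right)
      moreover have "?F u = ennreal (mangoldt_log_sum (exp (u / e)) * exp (- u))" using u by simp
      moreover have "?G u = ennreal (1 / d * (u powr - d / exp u))"
        using u d by (subst ennreal_mult') auto
      ultimately show ?thesis by (simp only:)
    qed simp
  qed
  also have "\<dots> = (\<integral>\<^sup>+u. ?F u \<partial>lborel) + (\<integral>\<^sup>+u. ?G u \<partial>lborel)"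
    by (rule nn_integral_add[OF nn_integral_mangoldt_log_sum_le(2)[OF e]]) measurable
  also have "(\<integral>\<^sup>+u. ?G u \<partial>lborel) = ennreal (1 / d) * ennreal (Gamma (1 - d))"
    using Gamma_conv_nn_integral_real[of "1 - d"] d by (subst nn_integral_cmult) auto
  also have "(\<integral>\<^sup>+u. ?F u \<partial>lborel) + ennreal (1 / d) * ennreal (Gamma (1 - d))
      \<le> ennreal (ln (1 + 1 / e)) + ennreal (1 / d) * ennreal (Gamma (1 - d))"
    by (intro add_right_mono nn_integral_mangoldt_log_sum_le(1)[OF e])
  finally have "ennreal (?C * exp (- ?a)) \<le> ennreal (ln (1 + 1 / e)) + ennreal (1 / d) * ennreal (Gamma (1 - d))" .
  moreover have "Gamma (1 - d) > 0" using d by (intro Gamma_real_pos) auto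
  moreover have "ln (1 + 1 / e) \<ge> 0" using e by simp
  ultimately have "ennreal (?C * exp (- ?a)) \<le> ennreal (ln (1 + 1 / e) + Gamma (1 - d) / d)"
    using d by (simp add: ennreal_plus flip: ennreal_mult')
  then show ?thesis
    using \<open>Gamma (1 - d) > 0\<close> \<open>ln (1 + 1 / e) \<ge> 0\<close> d by (subst (asm) ennreal_le_iff) auto
qed

text \<open>The upper half of Mertens' third theorem: the constant is identified by letting \<open>e\<close> and then
  \<open>d\<close> tend to \<open>0\<close> in the previous bound, since \<open>\<Gamma>'(1) = - \<gamma>\<close>.\<close>

lemma mertens_constant_le:
  fixes c x0 :: real
  assumes x0: "x0 > 1" and S: "\<And>t. t \<ge> x0 \<Longrightarrow> mangoldt_log_sum t \<ge> ln (ln t) + c"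
  shows "c \<le> euler_mascheroni"
proof -
  have bound: "c \<le> (Gamma (1 - d) - 1) / d" if d: "0 < d" "d < 1" for d :: real
  proof -
    define u where "u = ln x0"
    have "u > 0" using x0 by (simp add: u_def)
    \<comment> \<open>The singular terms - ln e and - ln (1 + 1 / e) cancel up to - ln (1 + e), and
      the exponential factor costs only terms of order e ln e; the threshold x0 thus drops
      out.\<close>
    have "((\<lambda>e::real. (c - ln e + 1 / d) * exp (- (e * u)) - ln (1 + 1 / e)) \<longlongrightarrow> c + 1 / d) (at_right 0)"
      using \<open>u > 0\<close> d by real_asymp
    moreover have "eventually (\<lambda>e. (c - ln e + 1 / d) * exp (- (e * u)) - ln (1 + 1 / e) \<le> Gamma (1 - d) / d)
        (at_right 0)"
    proof -
      have "eventually (\<lambda>e::real. c - ln e + 1 / d \<ge> 0) (at_right 0)" using d by real_asymp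
      moreover have "eventually (\<lambda>e::real. e > 0) (at_right 0)" by (rule eventually_at_right_less)
      ultimately show ?thesis
      proof eventually_elim
        case (elim e)
        then show ?case using mangoldt_log_sum_laplace_bound[OF x0 S _ d, of e] by (simp add: u_def)
      qed
    qed
    ultimately have "c + 1 / d \<le> Gamma (1 - d) / d"
      by (rule tendsto_upperbound) simp
    then show ?thesis by (simp add: diff_divide_distrib)
  qed
  have "((\<lambda>d::real. Gamma (1 - d)) has_real_derivative euler_mascheroni) (at 0)"
    by (auto intro!: derivative_eq_intros)
  then have "((\<lambda>d::real. (Gamma (1 - d) - 1) / d) \<longlongrightarrow> euler_mascheroni) (at_right 0)"
    by (auto simp: has_field_derivative_iff intro: tendsto_mono[OF at_le])
  moreover have "eventually (\<lambda>d::real. c \<le> (Gamma (1 - d) - 1) / d) (at_right 0)"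
    unfolding eventually_at_right_field using bound by (intro exI[of _ 1]) auto
  ultimately show ?thesis by (rule tendsto_lowerbound) simp
qed

section \<open>Explicit bounds for sums over the von Mangoldt function\<close>


text \<open>Partial summation in monotone form: F(t) = S(t) - A(t) / ln t - ln (ln t) + e / ln t is
  nondecreasing from x on. Between integers its derivative is (A(t) - ln t - e) / (t (ln t)^2),
  which the hypothesis makes nonnegative.\<close>

lemma mangoldt_log_sum_le:
  fixes x e :: real
  assumes x: "x > 1" and A: "\<And>t. t \<ge> x \<Longrightarrow> mangoldt_over_sum t \<ge> ln t + e"
  shows "mangoldt_log_sum x \<le> euler_mascheroni + ln (ln x) + (mangoldt_over_sum x - ln x - e) / ln x"
proof -
  \<comment> \<open>G keeps the summation limit n fixed, so it stays continuous up to the next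
    integer, where the floor in F has already jumped.\<close>
  define G where "G = (\<lambda>n t. (\<Sum>d = 1..n. mangoldt_log_coeff d) - (\<Sum>d = 1..n. mangoldt d / real d) / ln t
      - ln (ln t) + e / ln t)"
  define F where "F = (\<lambda>t. G (nat \<lfloor>t\<rfloor>) t)"
  have step: "F a \<le> F b" if ab: "x \<le> a" "a \<le> b" "b \<le> real (nat \<lfloor>a\<rfloor>) + 1" for a b
  proof -
    define n where "n = nat \<lfloor>a\<rfloor>"
    have pos: "t > 1" "ln t > 0" if "t \<ge> a" for t using that ab x by auto
    have "G n a \<le> G n b"
    proof (rule DERIV_nonneg_imp_increasing_open[OF ab(2)])
      fix t assume t: "a < t" "t < b"
      have "nat \<lfloor>t\<rfloor> = n" using t ab x unfolding n_def by (intro arg_cong[where f = nat]) linarith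
      then have At: "(\<Sum>d = 1..n. mangoldt d / real d) - ln t - e \<ge> 0"
        using A[of t] t ab by (simp add: mangoldt_over_sum_def)
      have "(G n has_real_derivative
          ((\<Sum>d = 1..n. mangoldt d / real d) - ln t - e) / (t * (ln t)\<^sup>2)) (at t)"
        unfolding G_def using pos[of t] t
        by (auto intro!: derivative_eq_intros simp: field_simps power2_eq_square)
      then show "\<exists>y. (G n has_real_derivative y) (at t) \<and> 0 \<le> y"
        using At pos[of t] t by (intro exI conjI) auto
    next
      show "continuous_on {a..b} (G n)"
        unfolding G_def using pos by (intro continuous_intros) force+
    qed
    also have "G n b = F b"
    \<comment> \<open>At the integer n + 1 the jump of S equals the jump of A divided by ln (n + 1),
      so F is continuous there.\<close>
    proof (cases "b = real n + 1")
      case True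
      have "mangoldt_log_coeff (Suc n) = mangoldt (Suc n) / real (Suc n) / ln b"
        using True by (simp add: mangoldt_log_coeff_def add.commute)
      moreover have "nat \<lfloor>b\<rfloor> = Suc n" using True by linarith
      ultimately show ?thesis by (simp add: F_def G_def add_divide_distrib)
    next
      case False
      then have "nat \<lfloor>b\<rfloor> = n" using ab x unfolding n_def by linarith
      then show ?thesis by (simp add: F_def)
    qed
    finally show ?thesis by (simp add: F_def n_def)
  qed
  have mono: "F a \<le> F b" if "x \<le> a" "a \<le> b" "nat \<lfloor>b\<rfloor> \<le> nat \<lfloor>a\<rfloor> + k" for a b k
    using that
  proof (induction k arbitrary: a)
    case 0
    then have "b \<le> real (nat \<lfloor>a\<rfloor>) + 1" using x by linarith
    then show ?case using step 0 by blast
  next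
    case (Suc k)
    define c where "c = real (nat \<lfloor>a\<rfloor>) + 1"
    show ?case
    proof (cases "b \<le> c")
      case True
      then show ?thesis using step Suc.prems by (auto simp: c_def)
    next
      case False
      have ac: "a \<le> c" using Suc.prems x unfolding c_def by linarith
      have "nat \<lfloor>c\<rfloor> = Suc (nat \<lfloor>a\<rfloor>)" unfolding c_def by linarith
      then have "F c \<le> F b" using Suc.IH[of c] Suc.prems False ac by simp
      moreover have "F a \<le> F c" using step Suc.prems ac by (auto simp: c_def)
      ultimately show ?thesis by simp
    qed
  qed
  \<comment> \<open>Since (A(t) - e) / ln t \<ge> 1, monotonicity of F makes F x + 1 an admissible
    constant c in \<open>mertens_constant_le\<close>.\<close>
  have "F x + 1 \<le> euler_mascheroni"
  proof (rule mertens_constant_le[OF x])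
    fix t assume t: "t \<ge> x"
    have lnt: "ln t > 0" using t x by simp
    have "F x \<le> F t" using mono[of x t "nat \<lfloor>t\<rfloor>"] t by simp
    also have "F t = mangoldt_log_sum t - (mangoldt_over_sum t - e) / ln t - ln (ln t)"
      by (simp add: F_def G_def mangoldt_log_sum_def mangoldt_over_sum_def diff_divide_distrib)
    finally have "F x \<le> mangoldt_log_sum t - (mangoldt_over_sum t - e) / ln t - ln (ln t)" .
    moreover have "(mangoldt_over_sum t - e) / ln t \<ge> 1"
      using A[OF t] lnt by (simp add: pos_le_divide_eq)
    ultimately show "mangoldt_log_sum t \<ge> ln (ln t) + (F x + 1)" by simp
  qed
  moreover have "F x = mangoldt_log_sum x - (mangoldt_over_sum x - ln x - e) / ln x - ln (ln x) - 1"
    using x by (simp add: F_def G_def mangoldt_log_sum_def mangoldt_over_sum_def diff_divide_distrib)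
  ultimately show ?thesis by simp
qed

section \<open>Chebyshev's method: factorials and step functions\<close>

lemma sum_mangoldt_div:
  assumes "N \<le> M"
  shows "(\<Sum>d = 1..M. mangoldt d * real (N div d)) = ln (fact N :: real)"
  using assms
proof (induction N)
  case (Suc N)
  \<comment> \<open>Passing from N to N + 1 raises N div d by one exactly when d divides N + 1. The
    fixed limit M lets factorials of different size share one summation range later.\<close>
  have "(\<Sum>d = 1..M. mangoldt d * real (Suc N div d)) =
      (\<Sum>d = 1..M. mangoldt d * real (N div d) + (if d dvd Suc N then mangoldt d else 0))"
    by (intro sum.cong) (auto simp: div_Suc dvd_eq_mod_eq_0 algebra_simps)
  also have "\<dots> = ln (fact N) + (\<Sum>d = 1..M. if d dvd Suc N then mangoldt d else 0)"
    using Suc by (simp add: sum.distrib)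
  also have "(\<Sum>d = 1..M. if d dvd Suc N then mangoldt d else (0::real)) = (\<Sum>d | d dvd Suc N. mangoldt d)"
    by (rule sum.mono_neutral_cong_right)
      (use Suc.prems in \<open>auto intro!: Suc_leI gr0I order_trans[OF dvd_imp_le]\<close>)
  also have "\<dots> = ln (real (Suc N))" using mangoldt_sum[of "Suc N", where ?'a = real] by simp
  finally show ?case by (simp add: ln_mult add.commute del: of_nat_Suc)
qed simp

text \<open>The function z ln z - z is an antiderivative of ln; the two bounds are length times
  endpoint value, obtained from ln y \<le> y - 1.\<close>

lemma x_ln_x_diff_bounds:
  fixes a b :: real
  assumes "0 < a" "a \<le> b"
  shows "(b * ln b - b) - (a * ln a - a) \<le> (b - a) * ln b"
    and "(b * ln b - b) - (a * ln a - a) \<ge> (b - a) * ln a"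
proof -
  have "a * ln (b / a) \<le> a * (b / a - 1)" using assms by (intro mult_left_mono ln_le_minus_one) auto
  then have "a * (ln b - ln a) \<le> b - a" using assms by (simp add: ln_div right_diff_distrib)
  then show "(b * ln b - b) - (a * ln a - a) \<le> (b - a) * ln b" by (simp add: algebra_simps)
  have "b * ln (a / b) \<le> b * (a / b - 1)" using assms by (intro mult_left_mono ln_le_minus_one) auto
  then have "b * (ln a - ln b) \<le> a - b" using assms by (simp add: ln_div right_diff_distrib)
  then show "(b * ln b - b) - (a * ln a - a) \<ge> (b - a) * ln a" by (simp add: algebra_simps)
qed

lemma ln_fact_floor_bounds:
  fixes z :: real
  assumes z: "z \<ge> 1"
  shows "\<bar>ln (fact (nat \<lfloor>z\<rfloor>)) - (z * ln z - z + 1)\<bar> \<le> ln z"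
proof -
  define g where "g = (\<lambda>z::real. z * ln z - z)"
  have N: "g (Suc n) + 1 \<le> ln (fact (Suc n)) \<and> ln (fact (Suc n)) \<le> g (Suc n) + 1 + ln (Suc n)" for n :: nat
  proof (induction n)
    case (Suc n)
    have "ln (fact (Suc (Suc n)) :: real) = ln (real (Suc (Suc n))) + ln (fact (Suc n))"
      by (simp only: fact_Suc of_nat_mult) (subst ln_mult_pos, auto)
    moreover have "g (Suc (Suc n)) - g (Suc n) \<le> ln (Suc (Suc n))" "g (Suc (Suc n)) - g (Suc n) \<ge> ln (Suc n)"
      using x_ln_x_diff_bounds[of "real (Suc n)" "real (Suc (Suc n))"] by (simp_all add: g_def)
    ultimately show ?case using Suc by linarith
  qed (simp add: g_def)
  define n where "n = nat \<lfloor>z\<rfloor> - 1"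
  have n: "nat \<lfloor>z\<rfloor> = Suc n" "real (Suc n) \<le> z" "z \<le> real (Suc n) + 1"
    using z unfolding n_def by linarith+
  have "g z - g (Suc n) \<le> (z - Suc n) * ln z" "g z - g (Suc n) \<ge> (z - Suc n) * ln (Suc n)"
    using x_ln_x_diff_bounds[of "real (Suc n)" z] n by (auto simp: g_def)
  moreover have "(z - Suc n) * ln z \<le> 1 * ln z" using z n by (intro mult_right_mono) auto
  moreover have "(z - Suc n) * ln (Suc n) \<ge> 0" using n by (intro mult_nonneg_nonneg) auto
  moreover have "ln (Suc n) \<le> ln z" using n by simp
  ultimately show ?thesis using N[of n] unfolding n(1) g_def by linarith
qed

lemma div_split_period:
  fixes a p q r :: nat
  assumes "a dvd p" "a > 0"
  shows "(p * q + r) div a = p div a * q + r div a"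
proof -
  have "p * q + r = a * (p div a * q) + r" using assms by simp
  then show ?thesis using assms(2) by (simp only: div_mult_self4)
qed

text \<open>Both inequalities are periodic in \<open>k\<close>, with periods 60 and 36, because the coefficients
  weighted by the reciprocals of the divisors add up to zero. They were found by linear programming:
  the left sides are step functions of \<open>k = \<lfloor>3 y\<rfloor>\<close> approximating \<open>3 (1 - frac y)\<close> and \<open>3 frac y\<close>
  from below.\<close>

lemma floor_kernel_60:
  fixes k :: nat
  shows "2 * (k div 3) + k div 30 + k div 60 + k mod 3 \<le> 2 + k div 4 + k div 5 + k div 6 + k div 10"
proof -
  define q r where "q = k div 60" and "r = k mod 60"
  have k: "k = 60 * q + r" by (simp add: q_def r_def)
  have "list_all (\<lambda>i. 2 * (i div 3) + i div 30 + i div 60 + i mod 3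
      \<le> 2 + i div 4 + i div 5 + i div 6 + (i div 10 :: int)) [0..59]"
    by code_simp
  moreover have "int r \<in> set [0..59]" by (simp add: r_def)
  ultimately have "2 * (int r div 3) + int r div 30 + int r div 60 + int r mod 3
      \<le> 2 + int r div 4 + int r div 5 + int r div 6 + int r div 10"
    unfolding list_all_iff by blast
  then have "2 * (r div 3) + r div 30 + r div 60 + r mod 3 \<le> 2 + r div 4 + r div 5 + r div 6 + r div 10"
    unfolding of_nat_le_iff[where ?'a = int, symmetric] of_nat_add of_nat_mult of_nat_div of_nat_mod
      of_nat_numeral .
  \<comment> \<open>A full period adds the same to both sides: 2 * 20 + 2 + 1 = 15 + 12 + 10 +
    6.\<close>
  moreover have "2 * (20 * q + b3) + (2 * q + b30) + (q + b60) + m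
      \<le> 2 + (15 * q + b4) + (12 * q + b5) + (10 * q + b6) + (6 * q + b10)"
    if "2 * b3 + b30 + b60 + m \<le> 2 + b4 + b5 + b6 + b10" for b3 b30 b60 m b4 b5 b6 b10 :: nat
    using that by simp
  moreover have "k div 3 = 20 * q + r div 3" "k div 30 = 2 * q + r div 30" "k div 60 = q + r div 60"
    "k div 4 = 15 * q + r div 4" "k div 5 = 12 * q + r div 5" "k div 6 = 10 * q + r div 6"
    "k div 10 = 6 * q + r div 10"
    unfolding k by (simp_all add: div_split_period)
  moreover have "k mod 3 = r mod 3" by (simp add: r_def mod_mod_cancel)
  ultimately show ?thesis by (simp only:)
qed

lemma floor_kernel_36:
  fixes k :: nat
  shows "k div 4 + k div 36 \<le> k mod 3 + k div 6 + k div 9"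
proof -
  define q r where "q = k div 36" and "r = k mod 36"
  have k: "k = 36 * q + r" by (simp add: q_def r_def)
  have "list_all (\<lambda>i. i div 4 + i div 36 \<le> i mod 3 + i div 6 + (i div 9 :: int)) [0..35]"
    by code_simp
  moreover have "int r \<in> set [0..35]" by (simp add: r_def)
  ultimately have "int r div 4 + int r div 36 \<le> int r mod 3 + int r div 6 + int r div 9"
    unfolding list_all_iff by blast
  then have "r div 4 + r div 36 \<le> r mod 3 + r div 6 + r div 9"
    unfolding of_nat_le_iff[where ?'a = int, symmetric] of_nat_add of_nat_div of_nat_mod of_nat_numeral .
  \<comment> \<open>The period cancels because 9 + 1 = 6 + 4.\<close>
  moreover have "(9 * q + b4) + (q + b36) \<le> m + (6 * q + b6) + (4 * q + b9)"
    if "b4 + b36 \<le> m + b6 + b9" for b4 b36 m b6 b9 :: nat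
    using that by simp
  moreover have "k div 4 = 9 * q + r div 4" "k div 36 = q + r div 36" "k div 6 = 6 * q + r div 6"
    "k div 9 = 4 * q + r div 9"
    unfolding k by (simp_all add: div_split_period)
  moreover have "k mod 3 = r mod 3" by (simp add: r_def mod_mod_cancel)
  ultimately show ?thesis by (simp only:)
qed

context
  fixes x :: real
  assumes x: "x \<ge> 20"
begin

private definition T :: "nat \<Rightarrow> real" where
  "T a = ln (fact (nat \<lfloor>3 * x\<rfloor> div a))"

text \<open>Stirling's formula at z = 3 x / a. The assumption x \<ge> 20 and a \<le> 60 ensure z
  \<ge> 1, while a \<ge> 3 gives z \<le> x, so that ln x serves as a common error term.\<close>

private lemma T_bounds:
  assumes a: "3 \<le> a" "a \<le> 60"
  shows "T a \<le> 3 / a * (x * ln 3 + x * ln x - x * ln a - x) + 1 + ln x"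
    and "T a \<ge> 3 / a * (x * ln 3 + x * ln x - x * ln a - x) + 1 - ln x"
proof -
  define z where "z = 3 * x / a"
  have z: "z \<ge> 1" "z \<le> x" using a x by (auto simp: z_def field_simps)
  have "\<lfloor>z\<rfloor> = \<lfloor>3 * x\<rfloor> div int a"
    using floor_divide_real_eq_div[of "int a" "3 * x"] by (simp add: z_def)
  then have "nat \<lfloor>z\<rfloor> = nat \<lfloor>3 * x\<rfloor> div a" using x by (simp add: nat_div_distrib)
  then have "\<bar>T a - (z * ln z - z + 1)\<bar> \<le> ln z" using ln_fact_floor_bounds[OF z(1)] by (simp add: T_def)
  moreover have "ln z = ln 3 + ln x - ln a" using x a by (simp add: z_def ln_div ln_mult)
  moreover have "ln z \<le> ln x" using z by simp
  moreover have "z * (ln 3 + ln x - ln a) - z = 3 / a * (x * ln 3 + x * ln x - x * ln a - x)"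
    using a by (simp add: z_def field_simps)
  ultimately show "T a \<le> 3 / a * (x * ln 3 + x * ln x - x * ln a - x) + 1 + ln x"
    "T a \<ge> 3 / a * (x * ln 3 + x * ln x - x * ln a - x) + 1 - ln x"
    by (auto simp: abs_le_iff)
qed

text \<open>As a \<ge> 3, the argument of the factorial does not exceed the floor of x, so the sum
  up to x is already complete. Dividing by d first exhibits the variable k = \<lfloor>3 x /
  d\<rfloor> of the kernels.\<close>

private lemma T_eq:
  assumes "3 \<le> a"
  shows "T a = (\<Sum>d = 1..nat \<lfloor>x\<rfloor>. mangoldt d * real (nat \<lfloor>3 * x\<rfloor> div d div a))"
proof -
  have "nat \<lfloor>3 * x\<rfloor> div a \<le> nat \<lfloor>3 * x\<rfloor> div 3" using assms by (intro div_le_mono2) auto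
  also have "\<dots> \<le> nat \<lfloor>x\<rfloor>"
  proof -
    have "real (nat \<lfloor>3 * x\<rfloor>) \<le> 3 * x" "x < real (nat \<lfloor>x\<rfloor>) + 1" using x by linarith+
    moreover have "W < (V + 1) * 3" if "real W \<le> 3 * x" "x < real V + 1" for V W :: nat
    proof -
      have "real W < real ((V + 1) * 3)" using that by simp
      then show ?thesis by (simp only: of_nat_less_iff)
    qed
    ultimately have "nat \<lfloor>3 * x\<rfloor> < (nat \<lfloor>x\<rfloor> + 1) * 3" by blast
    then have "nat \<lfloor>3 * x\<rfloor> div 3 < nat \<lfloor>x\<rfloor> + 1" by (rule less_mult_imp_div_less)
    then show ?thesis by simp
  qed
  finally have le: "nat \<lfloor>3 * x\<rfloor> div a \<le> nat \<lfloor>x\<rfloor>" .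
  have div_right_commute: "nat \<lfloor>3 * x\<rfloor> div d div a = nat \<lfloor>3 * x\<rfloor> div a div d" for d
    by (metis div_mult2_eq mult.commute)
  show ?thesis
    unfolding T_def div_right_commute using sum_mangoldt_div[OF le] by simp
qed

private lemma floor_div_bounds:
  assumes "d \<ge> 1"
  shows "real (nat \<lfloor>3 * x\<rfloor> div d) \<le> 3 * (x / d)" "3 * (x / d) \<le> real (nat \<lfloor>3 * x\<rfloor> div d) + 1"
proof -
  let ?W = "nat \<lfloor>3 * x\<rfloor>"
  have W: "real ?W \<le> 3 * x" "3 * x \<le> real ?W + 1" using x by linarith+
  have "?W div d * d \<le> ?W" by simp
  then have "real (?W div d) * real d \<le> real ?W" by (metis of_nat_le_iff of_nat_mult)
  then show "real (?W div d) \<le> 3 * (x / d)" using W assms by (simp add: field_simps)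
  have "?W + 1 \<le> (?W div d + 1) * d" using assms dividend_less_div_times[of d ?W] by simp
  then have "real (?W + 1) \<le> real ((?W div d + 1) * d)" by (simp only: of_nat_le_iff)
  then have "real ?W + 1 \<le> (real (?W div d) + 1) * real d" by (simp only: of_nat_mult of_nat_add of_nat_1)
  then show "3 * (x / d) \<le> real (?W div d) + 1" using W assms by (simp add: field_simps)
qed

text \<open>The left side is the sum of mangoldt d * (x / d - 1), and \<open>floor_kernel_60\<close>
  bounds x / d - 1 by floors. The reciprocals of 3, 4, 5, 6, 10, minus those of 30 and 60, add up to
  1, whence the main term x ln x; the seven Stirling errors, divided by 3, leave 7/3 ln x.\<close>

lemma mangoldt_over_sum_minus_psi_le:
  "x * mangoldt_over_sum x - chebyshev_psi x \<le>
    x * (ln x - 1 - (7/10 * ln 2 - 11/20 * ln 3 + ln 5 / 4)) + 1 + 7/3 * ln x"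
proof -
  let ?k = "\<lambda>d. nat \<lfloor>3 * x\<rfloor> div d"
  have "x / d - 1 \<le> (real (?k d div 3) + real (?k d div 4) + real (?k d div 5) + real (?k d div 6)
      + real (?k d div 10) - real (?k d div 30) - real (?k d div 60)) / 3" if d: "d \<ge> 1" for d
  proof -
    have "2 * real (?k d div 3) + real (?k d div 30) + real (?k d div 60) + real (?k d mod 3)
        \<le> 2 + real (?k d div 4) + real (?k d div 5) + real (?k d div 6) + real (?k d div 10)"
      using floor_kernel_60[of "?k d"] by linarith
    moreover have "real (?k d) = 3 * real (?k d div 3) + real (?k d mod 3)"
      by (metis mult_div_mod_eq of_nat_add of_nat_mult of_nat_numeral)
    moreover have "y - 1 \<le> (a3 + a4 + a5 + a6 + a10 - a30 - a60) / 3"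
      if "2 * a3 + a30 + a60 + m \<le> 2 + a4 + a5 + a6 + a10" "k = 3 * a3 + m" "3 * y \<le> k + 1"
      for y k m a3 a4 a5 a6 a10 a30 a60 :: real using that by simp
    ultimately show ?thesis using floor_div_bounds(2)[OF d] by blast
  qed
  then have "(\<Sum>d = 1..nat \<lfloor>x\<rfloor>. mangoldt d * (x / d - 1)) \<le> (\<Sum>d = 1..nat \<lfloor>x\<rfloor>. mangoldt d *
      ((real (?k d div 3) + real (?k d div 4) + real (?k d div 5) + real (?k d div 6)
      + real (?k d div 10) - real (?k d div 30) - real (?k d div 60)) / 3))"
    by (intro sum_mono mult_left_mono mangoldt_nonneg) auto
  also have "\<dots> = (T 3 + T 4 + T 5 + T 6 + T 10 - T 30 - T 60) / 3"
    by (simp add: T_eq ring_distribs sum.distrib sum_subtractf flip: sum_divide_distrib)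
  also have "(\<Sum>d = 1..nat \<lfloor>x\<rfloor>. mangoldt d * (x / d - 1)) = x * mangoldt_over_sum x - chebyshev_psi x"
    by (simp add: mangoldt_over_sum_def chebyshev_psi_def sum_distrib_left sum_subtractf algebra_simps)
  finally have "x * mangoldt_over_sum x - chebyshev_psi x \<le> (T 3 + T 4 + T 5 + T 6 + T 10 - T 30 - T 60) / 3" .
  moreover have "ln (4::real) = 2 * ln 2" "ln (6::real) = ln 2 + ln 3" "ln (10::real) = ln 2 + ln 5"
    "ln (30::real) = ln 2 + ln 3 + ln 5" "ln (60::real) = 2 * ln 2 + ln 3 + ln 5"
    using ln_mult_pos[of 2 "2::real"] ln_mult_pos[of 2 "3::real"] ln_mult_pos[of 2 "5::real"]
      ln_mult_pos[of 6 "5::real"] ln_mult_pos[of 2 "30::real"] by simp_all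
  ultimately show ?thesis
    using T_bounds(1)[of 3] T_bounds(1)[of 4] T_bounds(1)[of 5] T_bounds(1)[of 6] T_bounds(1)[of 10]
      T_bounds(2)[of 30] T_bounds(2)[of 60]
    by (simp add: ring_distribs)
qed

text \<open>The same method with \<open>floor_kernel_36\<close>: 1/4 + 1/36 = 1/6 + 1/9, so T 3
  alone supplies the main term, and the errors add up to (1 + 4/3) ln x.\<close>

lemma mangoldt_over_sum_ge:
  "x * mangoldt_over_sum x \<ge> x * (ln x - 1 + (ln 3 / 3 - 7/18 * ln 2)) - 7/3 * ln x"
proof -
  let ?k = "\<lambda>d. nat \<lfloor>3 * x\<rfloor> div d"
  have "x / d \<ge> real (?k d div 3) + (real (?k d div 4) + real (?k d div 36) - real (?k d div 6)
      - real (?k d div 9)) / 3" if d: "d \<ge> 1" for d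
  proof -
    have "real (?k d div 4) + real (?k d div 36) \<le> real (?k d mod 3) + real (?k d div 6) + real (?k d div 9)"
      using floor_kernel_36[of "?k d"] by linarith
    moreover have "real (?k d) = 3 * real (?k d div 3) + real (?k d mod 3)"
      by (metis mult_div_mod_eq of_nat_add of_nat_mult of_nat_numeral)
    moreover have "y \<ge> a3 + (a4 + a36 - a6 - a9) / 3"
      if "a4 + a36 \<le> m + a6 + a9" "k = 3 * a3 + m" "k \<le> 3 * y"
      for y k m a3 a4 a6 a9 a36 :: real using that by (simp add: field_simps)
    ultimately show ?thesis using floor_div_bounds(1)[OF d] by blast
  qed
  then have "(\<Sum>d = 1..nat \<lfloor>x\<rfloor>. mangoldt d * (x / d)) \<ge> (\<Sum>d = 1..nat \<lfloor>x\<rfloor>. mangoldt d *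
      (real (?k d div 3) + (real (?k d div 4) + real (?k d div 36) - real (?k d div 6)
      - real (?k d div 9)) / 3))"
    by (intro sum_mono mult_left_mono mangoldt_nonneg) auto
  also have "(\<Sum>d = 1..nat \<lfloor>x\<rfloor>. mangoldt d *
      (real (?k d div 3) + (real (?k d div 4) + real (?k d div 36) - real (?k d div 6)
      - real (?k d div 9)) / 3)) = T 3 + (T 4 + T 36 - T 6 - T 9) / 3"
    by (simp add: T_eq ring_distribs sum.distrib sum_subtractf flip: sum_divide_distrib)
  also have "(\<Sum>d = 1..nat \<lfloor>x\<rfloor>. mangoldt d * (x / d)) = x * mangoldt_over_sum x"
    by (simp add: mangoldt_over_sum_def sum_distrib_left algebra_simps)
  finally have "3 * (x * mangoldt_over_sum x) \<ge> 3 * T 3 + T 4 + T 36 - T 6 - T 9"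
    by (simp add: field_simps)
  moreover have "ln (4::real) = 2 * ln 2" "ln (6::real) = ln 2 + ln 3" "ln (9::real) = 2 * ln 3"
    "ln (36::real) = 2 * ln 2 + 2 * ln 3"
    using ln_mult_pos[of 2 "2::real"] ln_mult_pos[of 2 "3::real"] ln_mult_pos[of 3 "3::real"]
      ln_mult_pos[of 6 "6::real"] by simp_all
  ultimately show ?thesis
    using T_bounds(2)[of 3] T_bounds(2)[of 4] T_bounds(1)[of 6] T_bounds(1)[of 9] T_bounds(2)[of 36]
    by (simp add: ring_distribs)
qed

end

section \<open>Rational bounds for logarithms\<close>

lemma ln_2_bounds: "307 / 443 < ln (2::real)" "ln (2::real) < 4615 / 6658"
  using ln_approx_bounds[of 2 3] by (simp_all add: eval_nat_numeral)

text \<open>The fraction k / s is a lower bound for the binary logarithm of x, certified by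
  comparing powers. Together with its counterpart this reduces numerical logarithms to ln 2.\<close>

lemma ln_ge_if_two_power_le:
  fixes x :: real
  assumes "2 ^ k \<le> x ^ s" "x > 0" "s > 0"
  shows "ln x \<ge> k / s * ln 2"
proof -
  have "ln (2 ^ k) \<le> ln (x ^ s)" using assms by (intro ln_mono) auto
  then show ?thesis using assms by (simp add: ln_realpow field_simps)
qed

lemma ln_le_if_le_two_power:
  fixes x :: real
  assumes "x ^ s \<le> 2 ^ k" "x > 0" "s > 0"
  shows "ln x \<le> k / s * ln 2"
proof -
  have "ln (x ^ s) \<le> ln (2 ^ k)" using assms by (intro ln_mono) auto
  then show ?thesis using assms by (simp add: ln_realpow field_simps)
qed

text \<open>The quotient ln t / t decreases once ln t \<ge> 1; error terms of this shape can thus be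
  frozen at the left end x.\<close>

lemma ln_le_linear:
  fixes x t :: real
  assumes "x > 0" "ln x \<ge> 1" "t \<ge> x"
  shows "ln t \<le> t * (ln x / x)"
proof -
  have "ln t = ln x + ln (t / x)" using assms by (simp add: ln_div)
  also have "\<dots> \<le> ln x + (t / x - 1)" using assms by (intro add_left_mono ln_le_minus_one) auto
  also have "\<dots> \<le> t / x * ln x"
  proof -
    have "1 * (t / x - 1) \<le> ln x * (t / x - 1)" using assms by (intro mult_right_mono) auto
    then show ?thesis by (simp add: algebra_simps)
  qed
  finally show ?thesis by simp
qed

lemma ln_one_plus_ge:
  fixes u :: real
  assumes "u > 0"
  shows "2 * u / (2 + u) \<le> ln (1 + u)"
  using ln_approx_bounds[of "1 + u" 1] assms by (simp add: add.commute)

section \<open>Large arguments\<close>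

lemma ln_divisor_sum_less_of_large:
  fixes m :: nat
  assumes large: "ln m \<ge> 900"
  shows "ln (divisor_sum m / m) < euler_mascheroni + ln (ln (2 * ln m))"
proof -
  define x where "x = ln (real m)"
  define l where "l = ln x"
  \<comment> \<open>The error 7/3 ln t / t of \<open>mangoldt_over_sum_ge\<close> is replaced by its
    value at x, so that one constant serves for all t \<ge> x.\<close>
  define e where "e = - 1 + (ln 3 / 3 - 7/18 * ln 2) - 7/3 * (l / x)"
  define g where "g = 7/10 * ln 2 - 11/20 * ln 3 + ln 5 / (4::real)"
  have x: "x \<ge> 900" using large by (simp add: x_def)
  have m: "m > 0" using large by (cases "m = 0") auto
  have ln900_ge: "ln (900::real) \<ge> 49 / 5 * ln 2" using ln_ge_if_two_power_le[of 49 900 5] by simp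
  moreover have "l \<ge> ln 900" using x by (simp add: l_def)
  ultimately have l: "l \<ge> 67 / 10" using ln_2_bounds by simp
  have "ln (900::real) \<le> 59 / 6 * ln 2" using ln_le_if_le_two_power[of 900 6 59] by simp
  then have ln900: "ln (900::real) \<le> 682 / 100" "ln (900::real) \<ge> 1"
    using ln_2_bounds ln900_ge by simp_all
  have lx: "l / x \<le> 758 / 100000"
  proof -
    have "l \<le> x * (ln 900 / 900)" unfolding l_def by (rule ln_le_linear) (use x ln900 in auto)
    also have "\<dots> \<le> x * (758 / 100000)" using x ln900 by (intro mult_left_mono) auto
    finally show ?thesis using x by (simp add: field_simps)
  qed
  have lower: "mangoldt_over_sum t \<ge> ln t + e" if t: "t \<ge> x" for t
  proof -
    have "t * mangoldt_over_sum t \<ge> t * (ln t - 1 + (ln 3 / 3 - 7/18 * ln 2)) - 7/3 * ln t"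
      using mangoldt_over_sum_ge[of t] x t by simp
    moreover have "ln t \<le> t * (l / x)" unfolding l_def by (rule ln_le_linear) (use x t l in \<open>auto simp: l_def\<close>)
    ultimately have "t * mangoldt_over_sum t \<ge> t * (ln t + e)"
      by (simp add: e_def algebra_simps)
    then show ?thesis using x t by simp
  qed
  have S: "mangoldt_log_sum x \<le> euler_mascheroni + ln l + (mangoldt_over_sum x - l - e) / l"
    unfolding l_def by (rule mangoldt_log_sum_le) (use x lower in auto)
  \<comment> \<open>All that remains of order 1 / l. The target exceeds the main term by ln (1 + ln
    2 / l), so y has to stay below ln 2 = 0.693... with a margin; the estimates give 0.657.\<close>
  define y where "y = mangoldt_over_sum x - l - e + 1 - chebyshev_psi x / x"
  have "ln (divisor_sum m / m) \<le> mangoldt_log_sum x + (x - chebyshev_psi x) / (x * l)"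
    using ln_divisor_sum_le_exchange[OF m, of x] x by (simp add: x_def l_def)
  also have "(x - chebyshev_psi x) / (x * l) = (1 - chebyshev_psi x / x) / l"
    using x l by (simp add: field_simps)
  also have "mangoldt_log_sum x + (1 - chebyshev_psi x / x) / l \<le> euler_mascheroni + ln l + y / l"
    using S by (simp add: y_def diff_divide_distrib add_divide_distrib)
  finally have main: "ln (divisor_sum m / m) \<le> euler_mascheroni + ln l + y / l" .
  have "y \<le> 657 / 1000"
  proof -
    have "x * mangoldt_over_sum x - chebyshev_psi x \<le> x * (l - 1 - g) + 1 + 7/3 * l"
      using mangoldt_over_sum_minus_psi_le[of x] x by (simp add: l_def g_def)
    then have "(x * mangoldt_over_sum x - chebyshev_psi x) / x \<le> (x * (l - 1 - g) + 1 + 7/3 * l) / x"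
      using x by (intro divide_right_mono) auto
    then have "mangoldt_over_sum x - chebyshev_psi x / x \<le> l - 1 - g + 1 / x + 7/3 * (l / x)"
      using x by (simp add: add_divide_distrib diff_divide_distrib)
    then have "y \<le> 1 - (g + (ln 3 / 3 - 7/18 * ln 2)) + 1 / x + 14/3 * (l / x)"
      by (simp add: y_def e_def)
    moreover have "g + (ln 3 / 3 - 7/18 * ln 2) \<ge> 3795 / 10000"
    proof -
      have "ln (3::real) \<le> 65 / 41 * ln 2" using ln_le_if_le_two_power[of 3 41 65] by simp
      moreover have "ln (5::real) \<ge> 65 / 28 * ln 2" using ln_ge_if_two_power_le[of 65 5 28] by simp
      ultimately show ?thesis using ln_2_bounds by (simp add: g_def)
    qed
    moreover have "1 / x \<le> 1 / 900" using x by (simp add: field_simps)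
    ultimately show ?thesis using lx by simp
  qed
  then have "y / l \<le> 657 / 1000 / l" using l by (intro divide_right_mono) auto
  \<comment> \<open>The right side is the minorant of ln (1 + ln 2 / l) from
    \<open>ln_one_plus_ge\<close>; the gap between 0.657 and ln 2 suffices because l \<ge>
    6.7.\<close>
  also have "\<dots> < 2 * (ln 2 / l) / (2 + ln 2 / l)"
  proof -
    have "2 * (ln 2 / l) / (2 + ln 2 / l) = 2 * ln 2 / (2 * l + ln 2)"
      using l by (simp add: field_simps)
    moreover have "657 / 1000 * (2 * l + ln 2) < 2 * ln 2 * l"
    proof -
      have "657 / 1000 * (2 * l + ln 2) \<le> 1314 / 1000 * l + 657 / 1000 * (4615 / 6658)"
        using ln_2_bounds by simp
      also have "\<dots> < 2 * (307 / 443) * l" using l by simp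
      also have "\<dots> \<le> 2 * ln 2 * l" using l ln_2_bounds by (intro mult_right_mono) auto
      finally show ?thesis .
    qed
    ultimately show ?thesis using l ln_2_bounds
      by (simp add: pos_less_divide_eq pos_divide_less_eq add_pos_pos)
  qed
  also have "\<dots> \<le> ln (1 + ln 2 / l)" using l by (intro ln_one_plus_ge) auto
  also have "\<dots> = ln ((l + ln 2) / l)" using l by (simp add: add_divide_distrib)
  also have "\<dots> = ln (l + ln 2) - ln l" using l ln_2_bounds by (subst ln_div) auto
  also have "l + ln 2 = ln (2 * ln m)" using x by (simp add: l_def x_def ln_mult_pos)
  finally show ?thesis using main by simp
qed

section \<open>Moderate arguments\<close>


text \<open>Concavity of ln is used twice, first inside and then outside; a > 1/2 keeps the inner
  logarithms positive.\<close>

lemma ln_ln_concave_chord: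
  fixes a b L :: real
  assumes "1 / 2 < a" "a < b" "a \<le> L" "L \<le> b"
  shows "ln (ln (2 * L)) \<ge> (b - L) / (b - a) * ln (ln (2 * a)) + (L - a) / (b - a) * ln (ln (2 * b))"
proof -
  define t where "t = (L - a) / (b - a)"
  have t: "0 \<le> t" "t \<le> 1" using assms by (auto simp: t_def field_simps)
  have t': "1 - t = (b - L) / (b - a)" using assms by (simp add: t_def field_simps)
  have "L = a + t * (b - a)" using assms by (simp add: t_def)
  then have L: "2 * L = (1 - t) * (2 * a) + t * (2 * b)" by (simp add: algebra_simps)
  have pos: "ln (2 * a) > 0" "ln (2 * b) > 0" using assms by auto
  have "(1 - t) * ln (ln (2 * a)) + t * ln (ln (2 * b)) \<le> ln ((1 - t) * ln (2 * a) + t * ln (2 * b))"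
    using concave_onD[OF ln_concave t, of "ln (2 * a)" "ln (2 * b)"] pos by simp
  also have "\<dots> \<le> ln (ln (2 * L))"
  proof (rule ln_mono)
    show "(1 - t) * ln (2 * a) + t * ln (2 * b) \<le> ln (2 * L)"
      unfolding L using concave_onD[OF ln_concave t, of "2 * a" "2 * b"] assms by simp
    have "ln (2 * a) \<le> ln (2 * b)" using assms by simp
    then have "ln (2 * a) \<le> (1 - t) * ln (2 * a) + t * ln (2 * b)"
      using mult_left_mono[of "ln (2 * a)" "ln (2 * b)" t] t by (simp add: algebra_simps)
    then show "0 < (1 - t) * ln (2 * a) + t * ln (2 * b)" using pos by linarith
  qed
  finally show ?thesis unfolding t' by (simp add: t_def)
qed

text \<open>Two rounds of comparison with powers of 2, where 307/443 bounds ln 2 from below. Callers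
  take k / s just below the binary logarithm of y, r as the resulting rational bound for ln y, and
  k' / s' likewise for r.\<close>

lemma ln_ln_ge:
  fixes y r q :: real
  assumes "2 ^ k \<le> y ^ s" "y > 0" "s > 0" "r \<le> k / s * (307 / 443)"
    and "2 ^ k' \<le> r ^ s'" "r > 0" "s' > 0" "q \<le> k' / s' * (307 / 443)"
  shows "q \<le> ln (ln y)"
proof -
  have "r \<le> k / s * ln 2"
    using assms(3,4) ln_2_bounds mult_left_mono[of "307 / 443" "ln 2" "k / s"] by simp
  also have "\<dots> \<le> ln y" by (rule ln_ge_if_two_power_le[OF assms(1-3)])
  finally have r: "r \<le> ln y" .
  have "q \<le> k' / s' * ln 2"
    using assms(7,8) ln_2_bounds mult_left_mono[of "307 / 443" "ln 2" "k' / s'"] by simp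
  also have "\<dots> \<le> ln r" by (rule ln_ge_if_two_power_le[OF assms(5-7)])
  also have "\<dots> \<le> ln (ln y)" using r assms(6) by (intro ln_mono) auto
  finally show ?thesis .
qed

text \<open>For fixed \<open>z\<close> the exchange bound is affine in \<open>ln m\<close> while the target is concave, so it suffices to
  compare them at the two ends of an interval.\<close>

lemma ln_divisor_sum_less_of_endpoints:
  fixes m :: nat and a b z s w U V qa qb :: real
  assumes m: "m > 0" and z: "z > 1"
    and S: "mangoldt_log_sum z \<le> s" and psi: "chebyshev_psi z \<ge> w"
    and U: "z * ln z \<le> U" and V: "V \<le> z * ln z" "V > 0"
    and ab: "1 / 2 < a" "a \<le> ln m" "ln m \<le> b" "a \<le> w" "w < b"
    and qa: "qa \<le> ln (ln (2 * a))" "s + (a - w) / U < 19 / 33 + qa"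
    and qb: "qb \<le> ln (ln (2 * b))" "s + (b - w) / V < 19 / 33 + qb"
  shows "ln (divisor_sum m / m) < euler_mascheroni + ln (ln (2 * ln m))"
proof -
  define L where "L = ln (real m)"
  define c where "c = 1 / (z * ln z)"
  define p where "p = (b - L) / (b - a)"
  have zl: "z * ln z > 0" using V by linarith
  have p: "0 \<le> p" "p \<le> 1" "1 - p = (L - a) / (b - a)"
    using ab by (auto simp: p_def L_def field_simps)
  \<comment> \<open>At the left end a - w \<le> 0, so 1 / (z ln z) has to be bounded from below, by
    1 / U; at the right end the sign is reversed and V is used.\<close>
  have "(a - w) * c \<le> (a - w) / U"
  proof -
    have "1 / U \<le> c" unfolding c_def using U zl by (intro divide_left_mono) auto
    then show ?thesis using ab mult_left_mono_neg[of "1 / U" c "a - w"] by simp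
  qed
  then have ea: "s + (a - w) * c < 19 / 33 + ln (ln (2 * a))" using qa by linarith
  have "(b - w) * c \<le> (b - w) / V"
  proof -
    have "c \<le> 1 / V" unfolding c_def using V zl by (intro divide_left_mono) auto
    then show ?thesis using ab mult_left_mono[of c "1 / V" "b - w"] by simp
  qed
  then have eb: "s + (b - w) * c < 19 / 33 + ln (ln (2 * b))" using qb by linarith
  have "ln (divisor_sum m / m) \<le> mangoldt_log_sum z + (L - chebyshev_psi z) * c"
    using ln_divisor_sum_le_exchange[OF m z] by (simp add: L_def c_def)
  also have "\<dots> \<le> s + (L - w) * c"
    using S psi zl by (intro add_mono mult_right_mono) (auto simp: c_def)
  also have "\<dots> = p * (s + (a - w) * c) + (1 - p) * (s + (b - w) * c)"
  proof -
    have "p * (b - a) = b - L" using ab by (simp add: p_def)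
    then have "p * a + (1 - p) * b = L" by (simp add: algebra_simps)
    moreover have "p * (s + (a - w) * c) + (1 - p) * (s + (b - w) * c) = s + (p * a + (1 - p) * b - w) * c"
      by (simp add: algebra_simps)
    ultimately show ?thesis by simp
  qed
  also have "\<dots> \<le> p * (19 / 33 + ln (ln (2 * a))) + (1 - p) * (19 / 33 + ln (ln (2 * b)))"
    by (rule add_mono; rule mult_left_mono) (use ea eb p(1,2) in linarith)+
  also have "\<dots> = 19 / 33 + (p * ln (ln (2 * a)) + (1 - p) * ln (ln (2 * b)))"
    by (simp add: field_simps)
  also have "\<dots> \<le> 19 / 33 + ln (ln (2 * L))"
    using ln_ln_concave_chord[of a b L, folded p_def p(3)] ab by (simp add: L_def)
  finally show ?thesis using euler_mascheroni_gt_19_over_33 by (simp add: L_def)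
qed

section \<open>Prime tables by sieving, and values at small cutoffs\<close>

lemma set_sieve:
  fixes N :: nat and qs :: "int list"
  assumes "\<And>q. q \<in> set qs \<Longrightarrow> q > 1" "\<And>q::nat. prime q \<Longrightarrow> q * q \<le> N \<Longrightarrow> int q \<in> set qs"
  shows "set (filter (\<lambda>n. list_all (\<lambda>q. n = q \<or> n mod q \<noteq> 0) qs) [2..int N]) = int ` {p. prime p \<and> p \<le> N}"
proof (intro equalityI subsetI)
  fix i assume i: "i \<in> set (filter (\<lambda>n. list_all (\<lambda>q. n = q \<or> n mod q \<noteq> 0) qs) [2..int N])"
  define n where "n = nat i"
  have n: "i = int n" "n \<ge> 2" "n \<le> N" using i by (auto simp: n_def)
  have "prime n"
  proof (rule ccontr)
    assume np: "\<not> prime n"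
    \<comment> \<open>A prime factor of the smaller cofactor does not exceed the square root of n,
      so it is among the trial divisors.\<close>
    obtain q where q: "prime q" "q dvd n" "q * q \<le> n"
    proof -
      obtain a where a: "a dvd n" "a \<noteq> 1" "a \<noteq> n" using np n by (auto simp: prime_nat_iff)
      then obtain b where ab: "n = a * b" by blast
      have "b \<noteq> 1" using a(3) ab by simp
      have "a * b \<noteq> 0" using n(2) unfolding ab by linarith
      then have "a \<noteq> 0" "b \<noteq> 0" by simp_all
      define c where "c = min a b"
      have "c dvd n" unfolding ab by (simp add: c_def min_def)
      moreover have "c * c \<le> n" unfolding ab c_def by (intro mult_le_mono) auto
      moreover have "c \<noteq> 1" using a(2) \<open>b \<noteq> 1\<close> by (simp add: c_def min_def)
      ultimately have c: "c dvd n" "c * c \<le> n" "c \<noteq> 1" .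
      obtain q where q: "prime q" "q dvd c" using prime_factor_nat[OF c(3)] by blast
      have "q \<le> c" using q \<open>a \<noteq> 0\<close> \<open>b \<noteq> 0\<close> by (intro dvd_imp_le) (simp_all add: c_def)
      then have "q * q \<le> c * c" by (rule mult_le_mono) fact
      then show ?thesis using that[of q] q c by (meson dvd_trans order_trans)
    qed
    have "int q \<in> set qs" using q n assms(2) by simp
    then have "i = int q \<or> i mod int q \<noteq> 0" using i by (auto simp: list_all_iff)
    moreover have "i mod int q = 0" using q n by (simp add: zmod_int[symmetric])
    ultimately have "n = q" using n by simp
    then have "q * q \<le> q * 1" using q by simp
    then show False using prime_gt_1_nat[OF q(1)] by (simp only: mult_le_cancel1) simp
  qed
  then show "i \<in> int ` {p. prime p \<and> p \<le> N}" using n by auto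
next
  fix i assume "i \<in> int ` {p. prime p \<and> p \<le> N}"
  then obtain p where p: "i = int p" "prime p" "p \<le> N" by auto
  have "i = q \<or> i mod q \<noteq> 0" if q: "q \<in> set qs" for q
  proof (rule ccontr)
    assume "\<not> ?thesis"
    then have "nat q dvd p" "nat q \<noteq> p" "nat q \<noteq> 1"
      using p(1) assms(1)[OF q] by (auto simp: mod_eq_0_iff_dvd nat_dvd_iff)
    then show False using p(2) by (auto simp: prime_nat_iff)
  qed
  then show "i \<in> set (filter (\<lambda>n. list_all (\<lambda>q. n = q \<or> n mod q \<noteq> 0) qs) [2..int N])"
    using p prime_ge_2_nat[OF p(2)] by (auto simp: list_all_iff)
qed

text \<open>Both sums reduce to integer products over primes: S(N) is at most the logarithm of the
  product of p / (p - 1), by \<open>sum_mangoldt_log_coeff_le_primes\<close> with e = 0, and psi(N)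
  is at least the logarithm of the product of p, higher prime powers being dropped.\<close>

lemma prime_product_bounds:
  fixes N K C D :: nat and ps :: "int list"
  assumes ps: "set ps = int ` {p. prime p \<and> p \<le> N}" "distinct ps"
    and K: "2 ^ K \<le> prod_list ps"
    and CD: "int D * prod_list ps \<le> int C * prod_list (map (\<lambda>p. p - 1) ps)" "D > 0"
  shows "mangoldt_log_sum (real N) \<le> ln (C / D)" "chebyshev_psi (real N) \<ge> K * ln 2"
proof -
  let ?P = "{p. prime p \<and> p \<le> N}"
  have finP: "finite ?P" by (rule finite_subset[of _ "{..N}"]) auto
  have p1: "real p > 1" if "p \<in> ?P" for p using that prime_gt_1_nat[of p] by simp
  have p0: "real p > 0" "real p - 1 > 0" if "p \<in> ?P" for p using p1[OF that] by simp_all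
  have prod: "prod_list (map g ps) = (\<Prod>p\<in>?P. g (int p))" for g :: "int \<Rightarrow> int"
    unfolding prod.distinct_set_conv_list[OF ps(2), symmetric] ps(1) by (subst prod.reindex) auto
  have A: "real_of_int (prod_list ps) = (\<Prod>p\<in>?P. real p)" using prod[of "\<lambda>p. p"] by simp
  have B: "real_of_int (prod_list (map (\<lambda>p. p - 1) ps)) = (\<Prod>p\<in>?P. real p - 1)"
    using prod[of "\<lambda>p. p - 1"] by simp
  have "(\<Sum>n = 1..N. mangoldt_log_coeff n * real n powr - 0) \<le> (\<Sum>p\<in>?P. - ln (1 - real p powr - (1 + 0)))"
    by (rule sum_mangoldt_log_coeff_le_primes) simp
  also have "(\<Sum>n = 1..N. mangoldt_log_coeff n * real n powr - 0) = mangoldt_log_sum (real N)"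
    by (simp add: mangoldt_log_sum_def)
  also have "(\<Sum>p\<in>?P. - ln (1 - real p powr - (1 + 0))) = (\<Sum>p\<in>?P. ln (real p / (real p - 1)))"
  proof (rule sum.cong)
    fix p assume "p \<in> ?P"
    then have "real p > 1" by (rule p1)
    then show "- ln (1 - real p powr - (1 + 0)) = ln (real p / (real p - 1))"
      using ln_div[of "real p - 1" "real p"] ln_div[of "real p" "real p - 1"]
      by (simp add: powr_minus diff_divide_distrib inverse_eq_divide)
  qed simp
  also have "\<dots> = ln (\<Prod>p\<in>?P. real p / (real p - 1))"
    by (intro ln_prod[symmetric] finP less_imp_neq[THEN not_sym] divide_pos_pos p0)
  also have "\<dots> \<le> ln (C / D)"
  proof (rule ln_mono)
    show "0 < (\<Prod>p\<in>?P. real p / (real p - 1))" by (intro prod_pos divide_pos_pos p0)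
    have pos: "0 < (\<Prod>p\<in>?P. real p - 1)" by (intro prod_pos p0)
    have "real_of_int (int D * prod_list ps) \<le> real_of_int (int C * prod_list (map (\<lambda>p. p - 1) ps))"
      using CD(1) by (simp only: of_int_le_iff)
    then have "D * (\<Prod>p\<in>?P. real p) \<le> C * (\<Prod>p\<in>?P. real p - 1)"
      by (simp only: of_int_mult A B of_int_of_nat_eq)
    then show "(\<Prod>p\<in>?P. real p / (real p - 1)) \<le> C / D"
      using pos CD(2) by (simp add: prod_dividef field_simps)
  qed
  finally show "mangoldt_log_sum (real N) \<le> ln (C / D)" .
  have "K * ln 2 = ln (2 ^ K)" by (simp add: ln_realpow)
  also have "\<dots> \<le> ln (\<Prod>p\<in>?P. real p)"
  proof (rule ln_mono)
    have "real_of_int (2 ^ K) \<le> real_of_int (prod_list ps)" using K by (simp only: of_int_le_iff)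
    then show "2 ^ K \<le> (\<Prod>p\<in>?P. real p)" unfolding A by simp
  qed simp
  also have "\<dots> = (\<Sum>p\<in>?P. ln (real p))" by (intro ln_prod finP less_imp_neq[THEN not_sym] p0)
  also have "\<dots> = (\<Sum>p\<in>?P. mangoldt p)" by (intro sum.cong) auto
  also have "\<dots> \<le> (\<Sum>n = 1..N. mangoldt n)"
    by (intro sum_mono2 mangoldt_nonneg) (auto simp: Suc_le_eq prime_gt_0_nat)
  finally show "chebyshev_psi (real N) \<ge> K * ln 2" by (simp add: chebyshev_psi_def)
qed

lemma mangoldt_eq_0:
  assumes "prime p" "prime q" "p \<noteq> q" "p dvd n" "q dvd n"
  shows "mangoldt n = (0::real)" "mangoldt_log_coeff n = 0"
proof -
  have "\<not> primepow n"
  proof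
    assume "primepow n"
    then obtain r k where "prime r" "n = r ^ k" by (auto simp: primepow_def)
    then have "p = r" "q = r" using assms by (metis prime_dvd_power primes_dvd_imp_eq)+
    then show False using assms by simp
  qed
  then show "mangoldt n = (0::real)" "mangoldt_log_coeff n = 0"
    by (simp_all add: mangoldt_def mangoldt_log_coeff_def)
qed

lemma mangoldt_numeral:
  "mangoldt 4 = ln (2::real)"
  "mangoldt 8 = ln (2::real)"
  "mangoldt 9 = ln (3::real)"
  "mangoldt 16 = ln (2::real)"
  "mangoldt 6 = (0::real)"
  "mangoldt 10 = (0::real)"
  "mangoldt 12 = (0::real)"
  "mangoldt 14 = (0::real)"
  "mangoldt 15 = (0::real)"
  "mangoldt 18 = (0::real)"
  "mangoldt 20 = (0::real)"
  "mangoldt 21 = (0::real)"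
  "mangoldt 22 = (0::real)"
  "mangoldt_log_coeff (Suc 0) = 0"
  "mangoldt_log_coeff 2 = 1 / 2"
  "mangoldt_log_coeff 3 = 1 / 3"
  "mangoldt_log_coeff 5 = 1 / 5"
  "mangoldt_log_coeff 7 = 1 / 7"
  "mangoldt_log_coeff 11 = 1 / 11"
  "mangoldt_log_coeff 13 = 1 / 13"
  "mangoldt_log_coeff 17 = 1 / 17"
  "mangoldt_log_coeff 19 = 1 / 19"
  "mangoldt_log_coeff 23 = 1 / 23"
  "mangoldt_log_coeff 4 = 1 / 8"
  "mangoldt_log_coeff 8 = 1 / 24"
  "mangoldt_log_coeff 9 = 1 / 18"
  "mangoldt_log_coeff 16 = 1 / 64"
  "mangoldt_log_coeff 6 = 0"
  "mangoldt_log_coeff 10 = 0"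
  "mangoldt_log_coeff 12 = 0"
  "mangoldt_log_coeff 14 = 0"
  "mangoldt_log_coeff 15 = 0"
  "mangoldt_log_coeff 18 = 0"
  "mangoldt_log_coeff 20 = 0"
  "mangoldt_log_coeff 21 = 0"
  "mangoldt_log_coeff 22 = 0"
proof -
  show "mangoldt 4 = ln (2::real)"
    using mangoldt_primepow'[of 2 2, where ?'a = real] by simp
  show "mangoldt 8 = ln (2::real)"
    using mangoldt_primepow'[of 2 3, where ?'a = real] by simp
  show "mangoldt 9 = ln (3::real)"
    using mangoldt_primepow'[of 3 2, where ?'a = real] by simp
  show "mangoldt 16 = ln (2::real)"
    using mangoldt_primepow'[of 2 4, where ?'a = real] by simp
  show "mangoldt 6 = (0::real)"
    by (rule mangoldt_eq_0(1)[of 2 3]) simp_all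
  show "mangoldt 10 = (0::real)"
    by (rule mangoldt_eq_0(1)[of 2 5]) simp_all
  show "mangoldt 12 = (0::real)"
    by (rule mangoldt_eq_0(1)[of 2 3]) simp_all
  show "mangoldt 14 = (0::real)"
    by (rule mangoldt_eq_0(1)[of 2 7]) simp_all
  show "mangoldt 15 = (0::real)"
    by (rule mangoldt_eq_0(1)[of 3 5]) simp_all
  show "mangoldt 18 = (0::real)"
    by (rule mangoldt_eq_0(1)[of 2 3]) simp_all
  show "mangoldt 20 = (0::real)"
    by (rule mangoldt_eq_0(1)[of 2 5]) simp_all
  show "mangoldt 21 = (0::real)"
    by (rule mangoldt_eq_0(1)[of 3 7]) simp_all
  show "mangoldt 22 = (0::real)"
    by (rule mangoldt_eq_0(1)[of 2 11]) simp_all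
  show "mangoldt_log_coeff (Suc 0) = 0"
    by (simp add: mangoldt_log_coeff_def)
  show "mangoldt_log_coeff 2 = 1 / 2"
    using mangoldt_log_coeff_primepow[of 2 1] by simp
  show "mangoldt_log_coeff 3 = 1 / 3"
    using mangoldt_log_coeff_primepow[of 3 1] by simp
  show "mangoldt_log_coeff 5 = 1 / 5"
    using mangoldt_log_coeff_primepow[of 5 1] by simp
  show "mangoldt_log_coeff 7 = 1 / 7"
    using mangoldt_log_coeff_primepow[of 7 1] by simp
  show "mangoldt_log_coeff 11 = 1 / 11"
    using mangoldt_log_coeff_primepow[of 11 1] by simp
  show "mangoldt_log_coeff 13 = 1 / 13"
    using mangoldt_log_coeff_primepow[of 13 1] by simp
  show "mangoldt_log_coeff 17 = 1 / 17"
    using mangoldt_log_coeff_primepow[of 17 1] by simp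
  show "mangoldt_log_coeff 19 = 1 / 19"
    using mangoldt_log_coeff_primepow[of 19 1] by simp
  show "mangoldt_log_coeff 23 = 1 / 23"
    using mangoldt_log_coeff_primepow[of 23 1] by simp
  show "mangoldt_log_coeff 4 = 1 / 8"
    using mangoldt_log_coeff_primepow[of 2 2] by simp
  show "mangoldt_log_coeff 8 = 1 / 24"
    using mangoldt_log_coeff_primepow[of 2 3] by simp
  show "mangoldt_log_coeff 9 = 1 / 18"
    using mangoldt_log_coeff_primepow[of 3 2] by simp
  show "mangoldt_log_coeff 16 = 1 / 64"
    using mangoldt_log_coeff_primepow[of 2 4] by simp
  show "mangoldt_log_coeff 6 = 0"
    by (rule mangoldt_eq_0(2)[of 2 3]) simp_all
  show "mangoldt_log_coeff 10 = 0"
    by (rule mangoldt_eq_0(2)[of 2 5]) simp_all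
  show "mangoldt_log_coeff 12 = 0"
    by (rule mangoldt_eq_0(2)[of 2 3]) simp_all
  show "mangoldt_log_coeff 14 = 0"
    by (rule mangoldt_eq_0(2)[of 2 7]) simp_all
  show "mangoldt_log_coeff 15 = 0"
    by (rule mangoldt_eq_0(2)[of 3 5]) simp_all
  show "mangoldt_log_coeff 18 = 0"
    by (rule mangoldt_eq_0(2)[of 2 3]) simp_all
  show "mangoldt_log_coeff 20 = 0"
    by (rule mangoldt_eq_0(2)[of 2 5]) simp_all
  show "mangoldt_log_coeff 21 = 0"
    by (rule mangoldt_eq_0(2)[of 3 7]) simp_all
  show "mangoldt_log_coeff 22 = 0"
    by (rule mangoldt_eq_0(2)[of 2 11]) simp_all
qed

lemma mangoldt_sums_5:
  "mangoldt_log_sum 5 = 139 / 120" "chebyshev_psi 5 = 2 * ln 2 + ln 3 + ln 5"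
proof -
  have eq: "{1..nat \<lfloor>5::real\<rfloor>} = {1..<6}" by auto
  show "mangoldt_log_sum 5 = 139 / 120" "chebyshev_psi 5 = 2 * ln 2 + ln 3 + ln 5"
    unfolding mangoldt_log_sum_def chebyshev_psi_def eq
    by (simp_all add: atLeastLessThan_nat_numeral mangoldt_numeral)
qed

lemma mangoldt_sums_23:
  "mangoldt_log_sum 23 \<le> 1737 / 1000"
  "chebyshev_psi 23 = 4 * ln 2 + 2 * ln 3 + ln 5 + ln 7 + ln 11 + ln 13 + ln 17 + ln 19 + ln 23"
proof -
  have eq: "{1..nat \<lfloor>23::real\<rfloor>} = {1..<24}" by auto
  show "mangoldt_log_sum 23 \<le> 1737 / 1000"
    "chebyshev_psi 23 = 4 * ln 2 + 2 * ln 3 + ln 5 + ln 7 + ln 11 + ln 13 + ln 17 + ln 19 + ln 23"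
    unfolding mangoldt_log_sum_def chebyshev_psi_def eq
    by (simp_all add: atLeastLessThan_nat_numeral mangoldt_numeral)
qed

text \<open>The cutoff is matched to the range: psi(5), like psi at 23, 128 and 450 in the later
  cases, lies between the two ends for ln m, so the correction (ln m - psi(z)) / (z ln z) is
  negative at the left end and positive at the right end.\<close>

lemma ln_divisor_sum_less_5:
  fixes m :: nat
  assumes "m \<ge> 8" "ln m \<le> 7"
  shows "ln (divisor_sum m / m) < euler_mascheroni + ln (ln (2 * ln m))"
proof -
  have "ln (8::real) \<ge> 3 / 1 * ln 2" using ln_ge_if_two_power_le[of 3 8 1] by simp
  then have "ln (8::real) \<ge> 207 / 100" using ln_2_bounds by simp
  also have "ln (8::real) \<le> ln m" using assms by simp
  finally have a: "207 / 100 \<le> ln m" .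
  have l3: "ln (3::real) \<ge> 19 / 12 * ln 2" using ln_ge_if_two_power_le[of 19 3 12] by simp
  have l5: "ln (5::real) \<ge> 23 / 10 * ln 2" "ln (5::real) \<le> 7 / 3 * ln 2"
    using ln_ge_if_two_power_le[of 23 5 10] ln_le_if_le_two_power[of 5 3 7] by simp_all
  have psi: "407 / 100 \<le> chebyshev_psi 5"
    using l3 l5 ln_2_bounds by (simp add: mangoldt_sums_5)
  have qa: "346 / 1000 \<le> ln (ln (2 * (207 / 100 :: real)))"
    by (rule ln_ln_ge[where k = 43 and s = 21 and r = "1419 / 1000" and k' = 1 and s' = 2]) (simp_all add: power_divide)
  have qb: "962 / 1000 \<le> ln (ln (2 * (7 :: real)))"
    by (rule ln_ln_ge[where k = 19 and s = 5 and r = "263 / 100" and k' = 25 and s' = 18]) (simp_all add: power_divide)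
  show ?thesis
    by (rule ln_divisor_sum_less_of_endpoints[where z = 5 and s = "139 / 120" and w = "407 / 100"
          and U = "809 / 100" and V = "796 / 100" and a = "207 / 100" and b = 7, OF _ _ _ psi _ _ _ _ a _ _ _ qa _ qb])
      (use assms l5 ln_2_bounds in \<open>auto simp: mangoldt_sums_5\<close>)
qed

lemma ln_divisor_sum_less_23:
  fixes m :: nat
  assumes "ln m \<ge> 7" "ln m \<le> 45"
  shows "ln (divisor_sum m / m) < euler_mascheroni + ln (ln (2 * ln m))"
proof -
  have m: "m > 0" using assms by (cases "m = 0") auto
  have l: "ln (3::real) \<ge> 3 / 2 * ln 2" "ln (5::real) \<ge> 9 / 4 * ln 2" "ln (7::real) \<ge> 11 / 4 * ln 2"
    "ln (11::real) \<ge> 10 / 3 * ln 2" "ln (13::real) \<ge> 11 / 3 * ln 2" "ln (17::real) \<ge> 4 * ln 2"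
    "ln (19::real) \<ge> 4 * ln 2" "ln (23::real) \<ge> 9 / 2 * ln 2" "ln (23::real) \<le> 23 / 5 * ln 2"
    using ln_ge_if_two_power_le[of 3 3 2] ln_ge_if_two_power_le[of 9 5 4] ln_ge_if_two_power_le[of 11 7 4]
      ln_ge_if_two_power_le[of 10 11 3] ln_ge_if_two_power_le[of 11 13 3] ln_ge_if_two_power_le[of 4 17 1]
      ln_ge_if_two_power_le[of 4 19 1] ln_ge_if_two_power_le[of 9 23 2] ln_le_if_le_two_power[of 23 5 23]
    by simp_all
  have psi: "218 / 10 \<le> chebyshev_psi 23"
    using l ln_2_bounds by (simp add: mangoldt_sums_23(2))
  have qa: "962 / 1000 \<le> ln (ln (2 * (7 :: real)))"
    by (rule ln_ln_ge[where k = 19 and s = 5 and r = "263 / 100" and k' = 25 and s' = 18]) (simp_all add: power_divide)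
  have qb: "1501 / 1000 \<le> ln (ln (2 * (45 :: real)))"
    by (rule ln_ln_ge[where k = 188 and s = 29 and r = "449 / 100" and k' = 13 and s' = 6]) (simp_all add: power_divide)
  show ?thesis
    by (rule ln_divisor_sum_less_of_endpoints[where z = 23 and s = "1737 / 1000" and w = "218 / 10"
          and U = "734 / 10" and V = "717 / 10" and a = 7 and b = 45, OF m _ mangoldt_sums_23(1) psi _ _ _ _ _ _ _ _ qa _ qb])
      (use assms l ln_2_bounds in auto)
qed

lemma mangoldt_sums_128:
  "mangoldt_log_sum 128 \<le> ln (879 / 100)" "chebyshev_psi 128 \<ge> 161 * ln 2"
proof -
  let ?qs = "[2, 3, 5, 7, 11] :: int list"
  define ps where "ps = filter (\<lambda>n. list_all (\<lambda>q. n = q \<or> n mod q \<noteq> 0) ?qs) [2..int 128]"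
  have small: "int q \<in> set ?qs" if q: "prime q" "q * q \<le> 128" for q :: nat
  proof -
    have "q < 12" using q(2) mult_le_mono[of 12 q 12 q] by (cases "q < 12") auto
    then have "q \<in> {0..<12}" by simp
    then show ?thesis using q(1) by (auto simp: atLeastLessThan_nat_numeral)
  qed
  have set: "set ps = int ` {p. prime p \<and> p \<le> 128}"
    unfolding ps_def by (rule set_sieve[OF _ small]) auto
  have "let ps = filter (\<lambda>n. list_all (\<lambda>q. n = q \<or> n mod q \<noteq> 0) ?qs) [2..128]
      in 2 ^ 161 \<le> prod_list ps \<and> 100 * prod_list ps \<le> 879 * prod_list (map (\<lambda>p. p - 1) ps)"
    by code_simp
  then have prods: "2 ^ 161 \<le> prod_list ps"
      "int 100 * prod_list ps \<le> int 879 * prod_list (map (\<lambda>p. p - 1) ps)"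
    unfolding Let_def ps_def of_nat_numeral by (rule conjunct1, rule conjunct2)
  have "distinct ps" by (simp add: ps_def)
  note bounds = prime_product_bounds[OF set this prods]
  show "mangoldt_log_sum 128 \<le> ln (879 / 100)" "chebyshev_psi 128 \<ge> 161 * ln 2"
    using bounds by (simp_all only: of_nat_numeral zero_less_numeral simp_thms)
qed

lemma ln_divisor_sum_less_128:
  fixes m :: nat
  assumes "ln m \<ge> 45" "ln m \<le> 225"
  shows "ln (divisor_sum m / m) < euler_mascheroni + ln (ln (2 * ln m))"
proof -
  have m: "m > 0" using assms by (cases "m = 0") auto
  have "ln (879 / 100 :: real) \<le> 69 / 22 * ln 2" using ln_le_if_le_two_power[of "879 / 100" 22 69] by (simp add: power_divide)
  then have S: "mangoldt_log_sum 128 \<le> 2174 / 1000" using mangoldt_sums_128(1) ln_2_bounds by simp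
  have psi: "1115 / 10 \<le> chebyshev_psi 128" using mangoldt_sums_128(2) ln_2_bounds by simp
  have l: "ln (128::real) = 7 * ln 2" using ln_realpow[of 2 7] by simp
  have qa: "1501 / 1000 \<le> ln (ln (2 * (45 :: real)))"
    by (rule ln_ln_ge[where k = 188 and s = 29 and r = "449 / 100" and k' = 13 and s' = 6]) (simp_all add: power_divide)
  have qb: "1807 / 1000 \<le> ln (ln (2 * (225 :: real)))"
    by (rule ln_ln_ge[where k = 141 and s = 16 and r = "61 / 10" and k' = 60 and s' = 23]) (simp_all add: power_divide)
  show ?thesis
    by (rule ln_divisor_sum_less_of_endpoints[where z = 128 and s = "2174 / 1000" and w = "1115 / 10"
          and U = 622 and V = 620 and a = 45 and b = 225, OF m _ S psi _ _ _ _ _ _ _ _ qa _ qb])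
      (use assms l ln_2_bounds in auto)
qed

lemma mangoldt_sums_450:
  "mangoldt_log_sum 450 \<le> ln (1098 / 100)" "chebyshev_psi 450 \<ge> 612 * ln 2"
proof -
  let ?qs = "[2, 3, 5, 7, 11, 13, 17, 19] :: int list"
  define ps where "ps = filter (\<lambda>n. list_all (\<lambda>q. n = q \<or> n mod q \<noteq> 0) ?qs) [2..int 450]"
  have small: "int q \<in> set ?qs" if q: "prime q" "q * q \<le> 450" for q :: nat
  proof -
    have "q < 22" using q(2) mult_le_mono[of 22 q 22 q] by (cases "q < 22") auto
    then have "q \<in> {0..<22}" by simp
    then show ?thesis using q(1) by (auto simp: atLeastLessThan_nat_numeral)
  qed
  have set: "set ps = int ` {p. prime p \<and> p \<le> 450}"
    unfolding ps_def by (rule set_sieve[OF _ small]) auto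
  have "let ps = filter (\<lambda>n. list_all (\<lambda>q. n = q \<or> n mod q \<noteq> 0) ?qs) [2..450]
      in 2 ^ 612 \<le> prod_list ps \<and> 100 * prod_list ps \<le> 1098 * prod_list (map (\<lambda>p. p - 1) ps)"
    by code_simp
  then have prods: "2 ^ 612 \<le> prod_list ps"
      "int 100 * prod_list ps \<le> int 1098 * prod_list (map (\<lambda>p. p - 1) ps)"
    unfolding Let_def ps_def of_nat_numeral by (rule conjunct1, rule conjunct2)
  have "distinct ps" by (simp add: ps_def)
  note bounds = prime_product_bounds[OF set this prods]
  show "mangoldt_log_sum 450 \<le> ln (1098 / 100)" "chebyshev_psi 450 \<ge> 612 * ln 2"
    using bounds by (simp_all only: of_nat_numeral zero_less_numeral simp_thms)
qed

lemma ln_divisor_sum_less_450: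
  fixes m :: nat
  assumes "ln m \<ge> 225" "ln m \<le> 900"
  shows "ln (divisor_sum m / m) < euler_mascheroni + ln (ln (2 * ln m))"
proof -
  have m: "m > 0" using assms by (cases "m = 0") auto
  have "ln (1098 / 100 :: real) \<le> 83 / 24 * ln 2"
    using ln_le_if_le_two_power[of "1098 / 100" 24 83] by (simp add: power_divide)
  then have S: "mangoldt_log_sum 450 \<le> 2398 / 1000" using mangoldt_sums_450(1) ln_2_bounds by simp
  have psi: "424 \<le> chebyshev_psi 450" using mangoldt_sums_450(2) ln_2_bounds by simp
  have l: "ln (450::real) \<ge> 44 / 5 * ln 2" "ln (450::real) \<le> 53 / 6 * ln 2"
    using ln_ge_if_two_power_le[of 44 450 5] ln_le_if_le_two_power[of 450 6 53] by simp_all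
  have qa: "1807 / 1000 \<le> ln (ln (2 * (225 :: real)))"
    by (rule ln_ln_ge[where k = 141 and s = 16 and r = "61 / 10" and k' = 60 and s' = 23]) (simp_all add: power_divide)
  have qb: "2009 / 1000 \<le> ln (ln (2 * (900 :: real)))"
    by (rule ln_ln_ge[where k = 173 and s = 16 and r = "749 / 100" and k' = 29 and s' = 10]) (simp_all add: power_divide)
  show ?thesis
    by (rule ln_divisor_sum_less_of_endpoints[where z = 450 and s = "2398 / 1000" and w = 424
          and U = 2756 and V = 2744 and a = 225 and b = 900, OF m _ S psi _ _ _ _ _ _ _ _ qa _ qb])
      (use assms l ln_2_bounds in auto)
qed

section \<open>Assembling the bound, small m, and the conclusion\<close>

lemma divisor_sum_less:
  fixes m :: nat
  assumes "m \<ge> 8"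
  shows "divisor_sum m / m < exp euler_mascheroni * ln (2 * ln m)"
proof -
  have "ln (divisor_sum m / m) < euler_mascheroni + ln (ln (2 * ln m))"
    \<comment> \<open>The five ranges meet at ln m = 7, 45, 225 and 900.\<close>
    using ln_divisor_sum_less_5[OF assms] ln_divisor_sum_less_23[of m] ln_divisor_sum_less_128[of m]
      ln_divisor_sum_less_450[of m] ln_divisor_sum_less_of_large[of m] by linarith
  then have "exp (ln (divisor_sum m / m)) < exp (euler_mascheroni + ln (ln (2 * ln m)))" by simp
  moreover have "divisor_sum m / m > 0" using assms divisor_sum_pos[of m] by simp
  moreover have "ln (2 * ln m) > 0"
  proof -
    have "ln (8::real) \<ge> 3 / 1 * ln 2" using ln_ge_if_two_power_le[of 3 8 1] by simp
    moreover have "ln (8::real) \<le> ln m" using assms by simp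
    ultimately have "2 * ln m > 1" using ln_2_bounds by linarith
    then show ?thesis by simp
  qed
  ultimately show ?thesis by (simp add: exp_add)
qed

lemma divisor_sum_square_less_small:
  fixes m n :: nat
  assumes m: "1 \<le> m" "m < 8" and n: "n > 3" "n \<ge> m * (divisor_sum m + 2)"
  shows "real (divisor_sum m) ^ 2 < exp euler_mascheroni * real n * ln (ln (real n))"
proof -
  have exp: "exp (euler_mascheroni :: real) \<ge> 17 / 10"
  proof -
    have "1 + 19 / 33 + (19 / 33)\<^sup>2 / 2 \<le> exp (19 / 33 :: real)" by (rule exp_lower_Taylor_quadratic) simp
    also have "\<dots> \<le> exp euler_mascheroni" using euler_mascheroni_gt_19_over_33 by simp
    finally show ?thesis by (simp add: power2_eq_square)
  qed
  \<comment> \<open>Here t is sigma(m)^2, c an upper bound for sigma(m)^2 / n obtained from n \<ge>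
    m (sigma(m) + 2), k a lower bound for n, and 17/10 stands for exp of the Euler-Mascheroni
    constant. For m = 1 the hypothesis n > 3 supplies k = 4; k = 10 serves the other cases except m
    = 6, where c = 144/84 requires the full n \<ge> 84.\<close>
  have bound: "t < exp euler_mascheroni * real n * ln (ln (real n))"
    if "c / (17 / 10) < q" "q \<le> ln (ln (real k))" "k \<le> n" "k \<ge> 2" "c > 0" "t \<le> c * real n"
    for c q t :: real and k :: nat
  proof -
    have "ln (ln (real k)) \<le> ln (ln (real n))" using that by (intro ln_mono) auto
    then have "c / (17 / 10) < ln (ln (real n))" using that by linarith
    moreover have "0 < c / (17 / 10)" using that(5) by simp
    ultimately have pos: "0 \<le> ln (ln (real n))" and "c < 17 / 10 * ln (ln (real n))"
      by (simp_all add: field_simps)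
    note this(2)
    also have "\<dots> \<le> exp euler_mascheroni * ln (ln (real n))"
      using exp pos by (intro mult_right_mono)
    finally have "c * real n < exp euler_mascheroni * ln (ln (real n)) * real n"
      using n(1) by (intro mult_strict_right_mono) auto
    then show ?thesis using that(6) by (simp add: mult_ac)
  qed
  have q4: "3 / 10 \<le> ln (ln (real 4))"
    by (rule ln_ln_ge[where k = 2 and s = 1 and r = "138 / 100" and k' = 4 and s' = 9]) (simp_all add: power_divide)
  have q10: "82 / 100 \<le> ln (ln (real 10))"
    by (rule ln_ln_ge[where k = 33 and s = 10 and r = "228 / 100" and k' = 32 and s' = 27]) (simp_all add: power_divide)
  have q84: "138 / 100 \<le> ln (ln (real 84))"
    by (rule ln_ln_ge[where k = 6 and s = 1 and r = "415 / 100" and k' = 2 and s' = 1]) (simp_all add: power_divide)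
  have sigma3: "divisor_sum 3 = 4" using divisor_sum_prime_power_mult'[of 3 1 1] by simp
  have sigma: "divisor_sum 2 = 3" "divisor_sum 4 = 7" "divisor_sum 5 = 6" "divisor_sum 6 = 12" "divisor_sum 7 = 8"
    using divisor_sum_prime_power_mult'[of 2 1 1] divisor_sum_prime_power_mult'[of 2 1 2]
      divisor_sum_prime_power_mult'[of 5 1 1] divisor_sum_prime_power_mult'[of 2 3 1]
      divisor_sum_prime_power_mult'[of 7 1 1]
    by (simp_all add: sigma3 atMost_nat_numeral)
  have "m = 1 \<or> m = 2 \<or> m = 3 \<or> m = 4 \<or> m = 5 \<or> m = 6 \<or> m = 7" using m by linarith
  then consider "m = 1" | "m = 2" | "m = 3" | "m = 4" | "m = 5" | "m = 6" | "m = 7" by blast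
  then show ?thesis
  proof cases
    case 1
    show ?thesis by (rule bound[OF _ q4, of "1 / 4"]) (use 1 n in \<open>simp_all\<close>)
  next
    case 2
    show ?thesis by (rule bound[OF _ q10, of "9 / 10"]) (use 2 n in \<open>simp_all add: sigma\<close>)
  next
    case 3
    show ?thesis by (rule bound[OF _ q10, of "9 / 10"]) (use 3 n in \<open>simp_all add: sigma3\<close>)
  next
    case 4
    show ?thesis by (rule bound[OF _ q10, of "49 / 36"]) (use 4 n in \<open>simp_all add: sigma\<close>)
  next
    case 5
    show ?thesis by (rule bound[OF _ q10, of "9 / 10"]) (use 5 n in \<open>simp_all add: sigma\<close>)
  next
    case 6
    show ?thesis by (rule bound[OF _ q84, of "144 / 84"]) (use 6 n in \<open>simp_all add: sigma\<close>)
  next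
    case 7
    show ?thesis by (rule bound[OF _ q10, of "64 / 70"]) (use 7 n in \<open>simp_all add: sigma\<close>)
  qed
qed

theorem theorem1p5:
  fixes n :: nat
  assumes "n > 3"
    and "real (f n) \<ge> sqrt (exp euler_mascheroni * real n * ln (ln (real n)))"
  shows "practical n"
proof (rule ccontr)
  assume "\<not> practical n"
  then obtain m where m: "m > 0" "f n \<le> divisor_sum m" "n \<ge> m * (divisor_sum m + 2)"
    using not_practical_imp_gap[of n] assms(1) by auto
  have "real (divisor_sum m) ^ 2 < exp euler_mascheroni * real n * ln (ln (real n))"
  proof (cases "m < 8")
    case True
    then show ?thesis using divisor_sum_square_less_small[of m n] m assms(1) by simp
  next
    case False
    define s where "s = divisor_sum m"
    have s: "s \<ge> m" using divisor_sum_ge[of m] m by (simp add: s_def)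
    have "ln (8::real) \<ge> 3 / 1 * ln 2" using ln_ge_if_two_power_le[of 3 8 1] by simp
    moreover have "ln (8::real) \<le> ln m" using False by simp
    ultimately have lnm: "ln m > 1" using ln_2_bounds by linarith
    have nms: "real n \<ge> real m * real s"
    proof -
      have "m * s \<le> n" using m(3) by (simp add: s_def algebra_simps)
      then show ?thesis by (metis of_nat_le_iff of_nat_mult)
    qed
    have "real m * real m \<le> real n" using nms s mult_left_mono[of "real m" "real s" "real m"] by simp
    then have "ln (real m * real m) \<le> ln n" using m by (intro ln_mono) auto
    then have "2 * ln m \<le> ln n" using m by (simp add: ln_mult_pos)
    then have lnln: "ln (2 * ln m) \<le> ln (ln n)" using lnm by (intro ln_mono) auto
    \<comment> \<open>One factor m s is absorbed into n, leaving sigma(m) / m, to which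
      \<open>divisor_sum_less\<close> applies.\<close>
    have "real s ^ 2 = real s / real m * (real m * real s)" using m by (simp add: power2_eq_square)
    also have "\<dots> \<le> real s / real m * real n" using nms by (intro mult_left_mono) auto
    also have "\<dots> < exp euler_mascheroni * ln (2 * ln m) * real n"
      using divisor_sum_less[of m] False assms(1) by (intro mult_strict_right_mono) (auto simp: s_def)
    also have "\<dots> \<le> exp euler_mascheroni * ln (ln n) * real n"
      using lnln by (intro mult_right_mono mult_left_mono) auto
    finally show ?thesis by (simp add: s_def mult_ac)
  qed
  then have "real (divisor_sum m) < sqrt (exp euler_mascheroni * real n * ln (ln (real n)))"
    by (rule real_less_rsqrt)
  also have "\<dots> \<le> real (f n)" by (rule assms(2))
  finally show False using m(2) by simp
qed

end
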